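(* Let $A$ be a finite set and let $X \subset A^{\mathbb{Z}}$ be a subshift of finite type. If $X$ has the Myhill property then it has the Moore property. In other words, if $X$ has the Myhill property then it satisfies the Garden of Eden theorem.
   Context: $A^{\mathbb{Z}}$ carries the product topology ($A$ discrete) and the shift homeomorphism $\sigma$, $(\sigma(x))_i = x_{i+1}$. A subshift is a closed subset $X\subset A^{\mathbb{Z}}$ with $\sigma(X)=X$. It is of finite type if there are an integer $n\ge 0$ and $S\subset A^n$ such that $X$ is the set of all $x\in A^{\mathbb{Z}}$ with $(x_{i+1},\dots,x_{i+n})\in S$ for all $i\in\mathbb{Z}$. An endomorphism of $X$ is a continuous map $\tau\colon X\to X$ commuting with $\sigma$. Two configurations $x,y\in X$ are homoclinic if $\{i\in\mathbb{Z}: x_i\ne y_i\}$ is finite; an endomorphism is pre-injective if its restriction to every homoclinicity class of $X$ is injective. $X$ has the Moore property if every surjective endomorphism of $X$ is pre-injective; $X$ has the Myhill property if every pre-injective endomorphism of $X$ is surjective; $X$ satisfies the Garden of Eden theorem if it has both the Moore and the Myhill properties. *)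

theory Defs
  imports "HOL-Analysis.Analysis"
begin

text \<open>The topological space of bi-infinite configurations over the alphabet \<open>A\<close>. Its
  carrier \<open>PiE UNIV (\<lambda>_. A)\<close> consists of all \<open>x\<close> with \<open>x i \<in> A\<close> for every \<open>i\<close>.\<close>

definition full_shift :: "'a set \<Rightarrow> (int \<Rightarrow> 'a) topology" where
  "full_shift A = product_topology (\<lambda>_. discrete_topology A) UNIV"

definition shift :: "(int \<Rightarrow> 'a) \<Rightarrow> (int \<Rightarrow> 'a)" where
  "shift x = (\<lambda>i. x (i + 1))"

definition subshift :: "'a set \<Rightarrow> (int \<Rightarrow> 'a) set \<Rightarrow> bool" where
  "subshift A X \<longleftrightarrow> closedin (full_shift A) X \<and> shift ` X = X"

text \<open>Elements of \<open>A\<^sup>n\<close> are lists of length \<open>n\<close> over \<open>A\<close>;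
  \<open>window n x i\<close> is \<open>(x\<^bsub>i+1\<^esub>, \<dots>, x\<^bsub>i+n\<^esub>)\<close>.\<close>

definition window :: "nat \<Rightarrow> (int \<Rightarrow> 'a) \<Rightarrow> int \<Rightarrow> 'a list" where
  "window n x i = map (\<lambda>k. x (i + k)) [1..int n]"

definition subshift_of_finite_type :: "'a set \<Rightarrow> (int \<Rightarrow> 'a) set \<Rightarrow> bool" where
  "subshift_of_finite_type A X \<longleftrightarrow> subshift A X \<and>
     (\<exists>n S. S \<subseteq> {w. length w = n \<and> set w \<subseteq> A} \<and>
            X = {x \<in> topspace (full_shift A). \<forall>i. window n x i \<in> S})"

text \<open>Endomorphisms are total functions of which only the values on \<open>X\<close> matter.\<close>

definition endomorphism ::
  "'a set \<Rightarrow> (int \<Rightarrow> 'a) set \<Rightarrow> ((int \<Rightarrow> 'a) \<Rightarrow> (int \<Rightarrow> 'a)) \<Rightarrow> bool" where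
  "endomorphism A X \<tau> \<longleftrightarrow>
     continuous_map (subtopology (full_shift A) X) (subtopology (full_shift A) X) \<tau> \<and>
     (\<forall>x\<in>X. \<tau> (shift x) = shift (\<tau> x))"

definition homoclinic :: "(int \<Rightarrow> 'a) \<Rightarrow> (int \<Rightarrow> 'a) \<Rightarrow> bool" where
  "homoclinic x y \<longleftrightarrow> finite {i. x i \<noteq> y i}"

definition pre_injective ::
  "(int \<Rightarrow> 'a) set \<Rightarrow> ((int \<Rightarrow> 'a) \<Rightarrow> (int \<Rightarrow> 'a)) \<Rightarrow> bool" where
  "pre_injective X \<tau> \<longleftrightarrow> (\<forall>x\<in>X. inj_on \<tau> {y \<in> X. homoclinic x y})"

definition moore_property :: "'a set \<Rightarrow> (int \<Rightarrow> 'a) set \<Rightarrow> bool" where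
  "moore_property A X \<longleftrightarrow> (\<forall>\<tau>. endomorphism A X \<tau> \<and> \<tau> ` X = X \<longrightarrow> pre_injective X \<tau>)"

definition myhill_property :: "'a set \<Rightarrow> (int \<Rightarrow> 'a) set \<Rightarrow> bool" where
  "myhill_property A X \<longleftrightarrow> (\<forall>\<tau>. endomorphism A X \<tau> \<and> pre_injective X \<tau> \<longrightarrow> \<tau> ` X = X)"

definition satisfies_garden_of_eden :: "'a set \<Rightarrow> (int \<Rightarrow> 'a) set \<Rightarrow> bool" where
  "satisfies_garden_of_eden A X \<longleftrightarrow> moore_property A X \<and> myhill_property A X"

end

theory Submission
  imports Defs
begin

text \<open>
  Recode the subshift of finite type as the set of bi-infinite paths of a finite graph, so that
  endomorphisms become sliding block codes.

  Given a set of vertices \<open>D\<close> that paths can leave but not enter, delay the part of each path up to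
  its last recurrent vertex in \<open>D\<close> and fill the gap with a cycle through that vertex. This is an
  injective code, so the Myhill property makes it surjective, and then the history of such a vertex
  is forced to be the cycle. With the same argument on the reversed graph, every wandering path
  (one that leaves a strongly connected component) is asymptotic to forced cycles on both sides,
  and the wandering paths form finitely many orbits.

  A surjective code therefore permutes the wandering orbits, and it permutes the strongly connected
  components, so some power of it maps a given component onto itself. On a strongly connected graph
  a surjective code that identifies two homoclinic points has, for a suitable word \<open>u\<close>, preimages
  avoiding \<open>u\<close>; but words avoiding \<open>u\<close> are too few.
\<close>

section \<open>Sliding block codes\<close>

definition translate :: "int \<Rightarrow> (int \<Rightarrow> 'a) \<Rightarrow> (int \<Rightarrow> 'a)" where
  "translate k x = (\<lambda>i. x (i + k))"

text \<open>No local rule is named. Comparing \<open>x\<close> at \<open>i\<close> with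
  \<open>y\<close> at another position \<open>j\<close> puts locality and commutation with
  translations into one condition, and source and target may have different alphabets.\<close>

definition sliding_block_code ::
  "int \<Rightarrow> (int \<Rightarrow> 'a) set \<Rightarrow> (int \<Rightarrow> 'b) set \<Rightarrow> ((int \<Rightarrow> 'a) \<Rightarrow> (int \<Rightarrow> 'b)) \<Rightarrow> bool" where
  "sliding_block_code r X Y f \<longleftrightarrow> 0 \<le> r \<and> f ` X \<subseteq> Y \<and>
     (\<forall>x\<in>X. \<forall>y\<in>X. \<forall>i j. (\<forall>k. \<bar>k\<bar> \<le> r \<longrightarrow> x (i + k) = y (j + k)) \<longrightarrow> f x i = f y j)"

lemma sliding_block_codeI:
  assumes "0 \<le> r" and "\<And>x. x \<in> X \<Longrightarrow> f x \<in> Y"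
    and "\<And>x y i j. x \<in> X \<Longrightarrow> y \<in> X \<Longrightarrow> (\<And>k. \<bar>k\<bar> \<le> r \<Longrightarrow> x (i + k) = y (j + k)) \<Longrightarrow> f x i = f y j"
  shows "sliding_block_code r X Y f"
  using assms unfolding sliding_block_code_def by blast

lemma sliding_block_code_in: "sliding_block_code r X Y f \<Longrightarrow> x \<in> X \<Longrightarrow> f x \<in> Y"
  and sliding_block_code_nonneg: "sliding_block_code r X Y f \<Longrightarrow> 0 \<le> r"
  unfolding sliding_block_code_def by auto

lemma sliding_block_code_eq:
  assumes "sliding_block_code r X Y f" "x \<in> X" "y \<in> X"
    and "\<And>k. \<bar>k\<bar> \<le> r \<Longrightarrow> x (i + k) = y (j + k)"
  shows "f x i = f y j"
  using assms unfolding sliding_block_code_def by blast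

lemma sliding_block_code_comp:
  assumes f: "sliding_block_code r X Y f" and g: "sliding_block_code s Y Z g"
  shows "sliding_block_code (r + s) X Z (g \<circ> f)"
proof (rule sliding_block_codeI)
  fix x y i j assume x: "x \<in> X" and y: "y \<in> X"
    and eq: "\<And>k. \<bar>k\<bar> \<le> r + s \<Longrightarrow> x (i + k) = y (j + k)"
  have "f x (i + k) = f y (j + k)" if "\<bar>k\<bar> \<le> s" for k
  proof (rule sliding_block_code_eq[OF f x y])
    fix l :: int assume "\<bar>l\<bar> \<le> r"
    then show "x (i + k + l) = y (j + k + l)"
      using eq[of "k + l"] that by (simp add: add.assoc)
  qed
  then show "(g \<circ> f) x i = (g \<circ> f) y j"
    using sliding_block_code_eq[OF g] sliding_block_code_in[OF f] x y by simp
qed (use sliding_block_code_in[OF f] sliding_block_code_in[OF g]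
      sliding_block_code_nonneg[OF f] sliding_block_code_nonneg[OF g] in auto)

lemma sliding_block_code_funpow:
  assumes "sliding_block_code r X X f"
  shows "\<exists>s. sliding_block_code s X X (f ^^ n)"
proof (induction n)
  case 0
  have "sliding_block_code 0 X X (f ^^ 0)"
  proof (rule sliding_block_codeI)
    fix x y :: "int \<Rightarrow> 'a" and i j assume "\<And>k. \<bar>k\<bar> \<le> 0 \<Longrightarrow> x (i + k) = y (j + k)"
    from this[of 0] show "(f ^^ 0) x i = (f ^^ 0) y j" by simp
  qed auto
  then show ?case ..
next
  case (Suc n)
  then show ?case using sliding_block_code_comp[OF _ assms] by (auto simp del: comp_apply)
qed

lemma sliding_block_code_translate:
  assumes f: "sliding_block_code r X Y f" and "x \<in> X" "translate k x \<in> X"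
  shows "f (translate k x) = translate k (f x)"
proof
  fix i
  show "f (translate k x) i = translate k (f x) i"
    unfolding translate_def[of k "f x"]
    by (rule sliding_block_code_eq[OF f assms(3,2)]) (simp add: translate_def algebra_simps)
qed

text \<open>A difference of the images at \<open>i\<close> needs a difference of the arguments
  within distance \<open>r\<close>, so finitely many translates of the old difference set cover the
  new one.\<close>

lemma homoclinic_sliding_block_code:
  assumes f: "sliding_block_code r X Y f" and x: "x \<in> X" and y: "y \<in> X" and h: "homoclinic x y"
  shows "homoclinic (f x) (f y)"
proof -
  let ?D = "{i. x i \<noteq> y i}"
  have "{i. f x i \<noteq> f y i} \<subseteq> (\<Union>k\<in>{-r..r}. (\<lambda>d. d - k) ` ?D)"
  proof
    fix i assume "i \<in> {i. f x i \<noteq> f y i}"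
    then obtain k where "\<bar>k\<bar> \<le> r" "x (i + k) \<noteq> y (i + k)"
      using sliding_block_code_eq[OF f x y, of i i] by auto
    moreover have "i = (i + k) - k" by simp
    ultimately show "i \<in> (\<Union>k\<in>{-r..r}. (\<lambda>d. d - k) ` ?D)"
      by (intro UN_I[of k] image_eqI[of _ _ "i + k"]) auto
  qed
  moreover have "finite (\<Union>k\<in>{-r..r}. (\<lambda>d. d - k) ` ?D)" using h by (simp add: homoclinic_def)
  ultimately show ?thesis unfolding homoclinic_def by (rule finite_subset)
qed

section \<open>Endomorphisms of a subshift as sliding block codes\<close>

lemma topspace_full_shift: "topspace (full_shift A) = {x. \<forall>i. x i \<in> A}"
  by (auto simp: full_shift_def)

lemma openin_cylinder:
  assumes "finite F"
  shows "openin (full_shift A) {y \<in> topspace (full_shift A). \<forall>i\<in>F. y i = x i}"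
proof -
  let ?U = "\<lambda>i. if i \<in> F then A \<inter> {x i} else A"
  have "openin (product_topology (\<lambda>_. discrete_topology A) UNIV) (PiE UNIV ?U)"
    by (rule product_topology_basis) (auto intro: finite_subset[OF _ assms])
  moreover have "PiE UNIV ?U = {y \<in> topspace (full_shift A). \<forall>i\<in>F. y i = x i}"
    by (auto simp: topspace_full_shift PiE_iff split: if_splits)
  ultimately show ?thesis by (simp add: full_shift_def)
qed

lemma openin_full_shift_contains_cylinder:
  assumes "openin (full_shift A) U" "x \<in> U"
  shows "\<exists>r. \<forall>y\<in>topspace (full_shift A). (\<forall>k. \<bar>k\<bar> \<le> int r \<longrightarrow> y k = x k) \<longrightarrow> y \<in> U"
proof -
  obtain B where B: "x \<in> PiE UNIV B" "finite {i. B i \<noteq> topspace (discrete_topology A)}" "PiE UNIV B \<subseteq> U"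
    using product_topology_open_contains_basis[OF assms(1)[unfolded full_shift_def] assms(2)] by blast
  let ?F = "{i. B i \<noteq> A}"
  have "finite ((\<lambda>i. nat \<bar>i\<bar>) ` ?F)" using B(2) by simp
  then obtain r where r: "\<And>i. i \<in> ?F \<Longrightarrow> nat \<bar>i\<bar> \<le> r"
    by (meson finite_nat_set_iff_bounded_le image_eqI)
  show ?thesis
  proof (intro exI ballI impI)
    fix y assume y: "y \<in> topspace (full_shift A)" and eq: "\<forall>k. \<bar>k\<bar> \<le> int r \<longrightarrow> y k = x k"
    have "y i \<in> B i" for i
    proof (cases "i \<in> ?F")
      case True
      then have "y i = x i" using r[of i] eq by auto
      then show ?thesis using B(1) by auto
    next
      case False
      then show ?thesis using y by (auto simp: topspace_full_shift)
    qed
    then show "y \<in> U" using B(3) by auto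
  qed
qed

lemma subshift_translate:
  assumes "subshift A X" "x \<in> X"
  shows "translate k x \<in> X"
proof (induction k rule: int_induct[where k = 0])
  case base
  then show ?case using assms by (simp add: translate_def)
next
  case (step1 i)
  have "translate (i + 1) x = shift (translate i x)"
    by (auto simp: translate_def shift_def algebra_simps)
  then show ?case using step1 assms by (auto simp: subshift_def)
next
  case (step2 i)
  then obtain y where y: "y \<in> X" "translate i x = shift y" using assms by (auto simp: subshift_def)
  have "translate (i - 1) x j = y j" for j
    using fun_cong[OF y(2), of "j - 1"] by (simp add: translate_def shift_def algebra_simps)
  then show ?case using y by (metis ext)
qed

text \<open>Continuity of the coordinate at 0 gives a radius at each point, compactness of
  \<open>X\<close> makes it uniform, and commutation with the shift carries it to all coordinates.
  Conversely, every coordinate of a block code is locally constant.\<close>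

lemma curtis_hedlund_lyndon:
  fixes A :: "'a set"
  assumes A: "finite A" and X: "subshift A X"
  shows "endomorphism A X \<tau> \<longleftrightarrow> (\<exists>r. sliding_block_code r X X \<tau>)"
proof
  let ?T = "subtopology (full_shift A) X"
  have XA: "X \<subseteq> topspace (full_shift A)" using X by (simp add: subshift_def closedin_subset)
  then have top: "topspace ?T = X" by auto
  {
    assume e: "endomorphism A X \<tau>"
    then have cont: "continuous_map ?T ?T \<tau>" and comm: "\<And>x. x \<in> X \<Longrightarrow> \<tau> (shift x) = shift (\<tau> x)"
      by (auto simp: endomorphism_def)
    have inX: "\<tau> x \<in> X" if "x \<in> X" for x
      using continuous_map_image_subset_topspace[OF cont] that top by auto
    have comp: "compactin (full_shift A) X"
    proof (rule closedin_compact_space)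
      show "compact_space (full_shift A)"
        unfolding full_shift_def using A
        by (simp add: compact_space_product_topology compact_space_discrete_topology)
    qed (use X in \<open>simp add: subshift_def\<close>)
    have "\<exists>r. \<forall>y\<in>X. (\<forall>k. \<bar>k\<bar> \<le> int r \<longrightarrow> y k = x k) \<longrightarrow> \<tau> y 0 = \<tau> x 0" if x: "x \<in> X" for x
    proof -
      let ?C = "{z \<in> topspace (full_shift A). \<forall>i\<in>{0}. z i = \<tau> x i}"
      have "openin ?T {y \<in> topspace ?T. \<tau> y \<in> ?C \<inter> X}"
        by (intro openin_continuous_map_preimage[OF cont] openin_subtopology_Int openin_cylinder) simp
      then obtain U where U: "openin (full_shift A) U" "{y \<in> topspace ?T. \<tau> y \<in> ?C \<inter> X} = U \<inter> X"
        by (auto simp: openin_subtopology)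
      have "x \<in> U" using U(2) x inX[OF x] XA top by blast
      from openin_full_shift_contains_cylinder[OF U(1) this] obtain r where
        r: "\<And>y. y \<in> topspace (full_shift A) \<Longrightarrow> \<forall>k. \<bar>k\<bar> \<le> int r \<longrightarrow> y k = x k \<Longrightarrow> y \<in> U" by blast
      show ?thesis
      proof (intro exI ballI impI)
        fix y assume "y \<in> X" "\<forall>k. \<bar>k\<bar> \<le> int r \<longrightarrow> y k = x k"
        then have "y \<in> U \<inter> X" using r XA by blast
        then show "\<tau> y 0 = \<tau> x 0" using U(2) by blast
      qed
    qed
    then obtain R where R: "\<And>x y. x \<in> X \<Longrightarrow> y \<in> X \<Longrightarrow> (\<forall>k. \<bar>k\<bar> \<le> int (R x) \<longrightarrow> y k = x k) \<Longrightarrow> \<tau> y 0 = \<tau> x 0"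
      by metis
    define cyl where "cyl x = {y \<in> topspace (full_shift A). \<forall>i\<in>{- int (R x)..int (R x)}. y i = x i}" for x
    have "\<exists>F. finite F \<and> F \<subseteq> cyl ` X \<and> X \<subseteq> \<Union>F"
    proof (rule comp[unfolded compactin_def, THEN conjunct2, rule_format], intro conjI ballI)
      show "openin (full_shift A) U" if "U \<in> cyl ` X" for U
        using that unfolding cyl_def by (auto intro!: openin_cylinder)
      show "X \<subseteq> \<Union> (cyl ` X)" using XA unfolding cyl_def by blast
    qed
    then obtain G where G: "finite G" "G \<subseteq> X" "X \<subseteq> \<Union> (cyl ` G)"
      by (metis finite_subset_image)
    obtain r where r: "\<And>x. x \<in> G \<Longrightarrow> R x \<le> r"
      using G(1) by (intro that[of "Max (R ` G)"]) auto
    \<comment> \<open>Points that agree up to radius \<open>r\<close> lie in a common cylinder of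
      the finite cover, so both can be compared with its centre.\<close>
    have loc: "\<tau> y 0 = \<tau> z 0" if y: "y \<in> X" and z: "z \<in> X" and eq: "\<And>k. \<bar>k\<bar> \<le> int r \<Longrightarrow> y k = z k" for y z
    proof -
      obtain x where x: "x \<in> G" "y \<in> cyl x" using G(3) y by blast
      then have xX: "x \<in> X" and yx: "\<And>k. \<bar>k\<bar> \<le> int (R x) \<Longrightarrow> y k = x k"
        using G(2) unfolding cyl_def by (auto simp: abs_le_iff)
      have "z k = x k" if "\<bar>k\<bar> \<le> int (R x)" for k
        using yx[OF that] eq[of k] r[OF x(1)] that by simp
      then show ?thesis using R[OF xX y] R[OF xX z] yx by simp
    qed
    have shift_translate: "shift (translate i x) = translate (i + 1) x" for i and x :: "int \<Rightarrow> 'a"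
      by (auto simp: translate_def shift_def algebra_simps)
    have tr: "\<tau> (translate i x) = translate i (\<tau> x)" if x: "x \<in> X" for x i
    proof (induction i rule: int_induct[where k = 0])
      case base
      then show ?case by (simp add: translate_def)
    next
      case (step1 i)
      then show ?case using comm[OF subshift_translate[OF X x, of i]] by (simp add: shift_translate)
    next
      case (step2 i)
      \<comment> \<open>Commutation is known for forward shifts; a backward step cancels one shift
        by injectivity.\<close>
      have "shift (\<tau> (translate (i - 1) x)) = shift (translate (i - 1) (\<tau> x))"
        using comm[OF subshift_translate[OF X x, of "i - 1"]] step2 by (simp add: shift_translate)
      moreover have "inj (shift :: (int \<Rightarrow> 'a) \<Rightarrow> _)"
        by (rule inj_on_inverseI[where g = "translate (- 1)"]) (simp add: shift_def translate_def)
      ultimately show ?case by (simp add: inj_eq)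
    qed
    show "\<exists>r. sliding_block_code r X X \<tau>"
    proof (rule exI, rule sliding_block_codeI[of "int r"])
      fix x y i j assume x: "x \<in> X" and y: "y \<in> X" and eq: "\<And>k. \<bar>k\<bar> \<le> int r \<Longrightarrow> x (i + k) = y (j + k)"
      have "\<tau> (translate i x) 0 = \<tau> (translate j y) 0"
        by (rule loc[OF subshift_translate[OF X x] subshift_translate[OF X y]])
          (use eq in \<open>simp add: translate_def add.commute\<close>)
      then show "\<tau> x i = \<tau> y j" using x y by (simp add: tr) (simp add: translate_def)
    qed (use inX in auto)
  }
  assume "\<exists>r. sliding_block_code r X X \<tau>"
  then obtain r where s: "sliding_block_code r X X \<tau>" ..
  have "continuous_map ?T (product_topology (\<lambda>_. discrete_topology A) UNIV) \<tau>"
  proof (rule continuous_map_componentwise_UNIV[THEN iffD2], intro allI)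
    fix i
    show "continuous_map ?T (discrete_topology A) (\<lambda>x. \<tau> x i)"
      unfolding continuous_map_def
    proof (intro conjI allI impI)
      show "(\<lambda>x. \<tau> x i) \<in> topspace ?T \<rightarrow> topspace (discrete_topology A)"
        using sliding_block_code_in[OF s] XA top by (auto simp: topspace_full_shift)
      fix U
      show "openin ?T {x \<in> topspace ?T. \<tau> x i \<in> U}"
      proof (subst openin_subopen, intro ballI)
        fix x assume "x \<in> {x \<in> topspace ?T. \<tau> x i \<in> U}"
        then have x: "x \<in> X" "\<tau> x i \<in> U" using top by auto
        let ?C = "{y \<in> topspace (full_shift A). \<forall>l\<in>{i - r..i + r}. y l = x l}"
        have "openin ?T (?C \<inter> X)"
          by (intro openin_subtopology_Int openin_cylinder) simp
        moreover have "x \<in> ?C \<inter> X" using x XA by auto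
        moreover have "\<tau> y i = \<tau> x i" if "y \<in> ?C \<inter> X" for y
          by (rule sliding_block_code_eq[OF s]) (use that x in \<open>auto simp: abs_le_iff\<close>)
        then have "?C \<inter> X \<subseteq> {x \<in> topspace ?T. \<tau> x i \<in> U}" using x top by auto
        ultimately show "\<exists>T. openin ?T T \<and> x \<in> T \<and> T \<subseteq> {x \<in> topspace ?T. \<tau> x i \<in> U}" by blast
      qed
    qed
  qed
  moreover have "\<tau> (shift x) = shift (\<tau> x)" if x: "x \<in> X" for x
  proof -
    have "shift z = translate 1 z" for z :: "int \<Rightarrow> 'a" by (simp add: shift_def translate_def)
    then show ?thesis
      using sliding_block_code_translate[OF s x subshift_translate[OF X x], of 1] by simp
  qed
  ultimately show "endomorphism A X \<tau>"
    using sliding_block_code_in[OF s] top unfolding endomorphism_def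
    by (auto simp: continuous_map_in_subtopology full_shift_def)
qed

section \<open>Inserting cycles into paths\<close>

definition paths :: "('v \<Rightarrow> 'v \<Rightarrow> bool) \<Rightarrow> (int \<Rightarrow> 'v) set" where
  "paths E = {x. \<forall>i. E (x i) (x (i + 1))}"

lemma paths_step: "x \<in> paths E \<Longrightarrow> E (x i) (x (i + 1))"
  by (simp add: paths_def)

lemma translate_paths: "x \<in> paths E \<Longrightarrow> translate k x \<in> paths E"
  unfolding paths_def translate_def by (auto simp: algebra_simps) (metis add.assoc add.commute)

lemma paths_reach:
  assumes "x \<in> paths E" "i \<le> j"
  shows "E\<^sup>*\<^sup>* (x i) (x j)"
  using assms(2)
proof (induction j rule: int_ge_induct)
  case (step j)
  then show ?case using paths_step[OF assms(1), of j] by simp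
qed simp

lemma paths_reach_plus:
  assumes "x \<in> paths E" "i < j"
  shows "E\<^sup>+\<^sup>+ (x i) (x j)"
  using paths_reach[OF assms(1), of "i + 1" j] paths_step[OF assms(1), of i] assms(2)
  by (simp add: rtranclp_into_tranclp2)

lemma paths_splice:
  assumes "x \<in> paths E" "y \<in> paths E" "x a = y b"
  shows "(\<lambda>i. if i \<le> a then x i else y (i - a + b)) \<in> paths E"
  unfolding paths_def
proof (intro CollectI allI)
  fix i
  show "E (if i \<le> a then x i else y (i - a + b)) (if i + 1 \<le> a then x (i + 1) else y (i + 1 - a + b))"
    using paths_step[OF assms(1), of i] paths_step[OF assms(2), of "i - a + b"] assms(3)
    by (cases "i = a") (auto simp: algebra_simps)
qed

lemma paths_connect:
  assumes x: "x \<in> paths E" and y: "y \<in> paths E" and q: "(E ^^ q) (x a) (y b)"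
  obtains z where "z \<in> paths E" "\<And>i. i \<le> a \<Longrightarrow> z i = x i" "\<And>i. 0 \<le> i \<Longrightarrow> z (a + int q + i) = y (b + i)"
proof -
  obtain f where f: "f 0 = x a" "f q = y b" "\<And>i. i < q \<Longrightarrow> E (f i) (f (Suc i))"
    using q by (auto simp: relpowp_fun_conv)
  define z where "z i = (if i \<le> a then x i else if i \<le> a + int q then f (nat (i - a))
    else y (i - a - int q + b))" for i
  show ?thesis
  proof
    show "z \<in> paths E"
      unfolding paths_def
    proof (intro CollectI allI)
      fix i
      consider "i < a" | "a \<le> i" "i < a + int q" | "a + int q \<le> i" by linarith
      then show "E (z i) (z (i + 1))"
      proof cases
        case 1
        then show ?thesis using paths_step[OF x, of i] by (simp add: z_def)
      next
        case 2
        then have "z i = f (nat (i - a))" "z (i + 1) = f (Suc (nat (i - a)))"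
          using f(1) by (auto simp: z_def Suc_nat_eq_nat_zadd1 algebra_simps)
        then show ?thesis using f(3)[of "nat (i - a)"] 2 by auto
      next
        case 3
        then have "z i = y (i - a - int q + b)"
          using f by (auto simp: z_def)
        moreover have "z (i + 1) = y (i - a - int q + b + 1)"
          using 3 by (auto simp: z_def algebra_simps)
        ultimately show ?thesis using paths_step[OF y] by simp
      qed
    qed
    show "z i = x i" if "i \<le> a" for i using that by (simp add: z_def)
    show "z (a + int q + i) = y (b + i)" if "0 \<le> i" for i
      using that f by (cases "i = 0"; cases "q = 0") (auto simp: z_def algebra_simps)
  qed
qed

lemma periodic_multiple:
  fixes c :: "int \<Rightarrow> 'v"
  assumes "\<And>i. c (i + int n) = c i"
  shows "c (i + int n * int k) = c i"
proof (induction k)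
  case (Suc k)
  then show ?case using assms[of "i + int n * int k"] by (simp add: algebra_simps)
qed simp

section \<open>Recurrent vertices and closed paths of a finite graph\<close>

definition recurrent :: "('v \<Rightarrow> 'v \<Rightarrow> bool) \<Rightarrow> 'v \<Rightarrow> bool" where
  "recurrent E v \<longleftrightarrow> E\<^sup>+\<^sup>+ v v"

locale finite_graph =
  fixes E :: "'v \<Rightarrow> 'v \<Rightarrow> bool"
  assumes finite_edges: "finite {(v, w). E v w}"
begin

abbreviation V :: "'v set" where "V \<equiv> {v. \<exists>w. E v w}"

lemma finite_vertices: "finite V"
proof -
  have "V = fst ` {(v, w). E v w}" by force
  then show ?thesis using finite_edges by simp
qed

lemma paths_vertex: "x \<in> paths E \<Longrightarrow> x i \<in> V"
  using paths_step by blast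

lemma closed_path:
  assumes "recurrent E v"
  shows "\<exists>c n. c \<in> paths E \<and> c 0 = v \<and> 0 < n \<and> (\<forall>i. c (i + int n) = c i)"
proof -
  obtain n where n: "0 < n" "(E ^^ n) v v"
    using assms unfolding recurrent_def by (auto simp: tranclp_power)
  then obtain f where f: "f 0 = v" "f n = v" "\<And>i. i < n \<Longrightarrow> E (f i) (f (Suc i))"
    by (auto simp: relpowp_fun_conv)
  define c where "c i = f (nat (i mod int n))" for i
  have "c \<in> paths E"
    unfolding paths_def
  proof (intro CollectI allI)
    fix i
    let ?m = "nat (i mod int n)"
    have m: "?m < n" using n(1) by (simp add: nat_less_iff)
    have i: "i mod int n = int ?m" using n(1) by simp
    have "c (i + 1) = f (Suc ?m)"
    proof (cases "Suc ?m = n")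
      case True
      then have "(i + 1) mod int n = 0"
        by (metis i mod_add_left_eq mod_self of_nat_Suc add.commute)
      then show ?thesis using True f by (simp add: c_def)
    next
      case False
      then have "(i + 1) mod int n = int (Suc ?m)"
        using m by (metis Suc_lessI add.commute i mod_add_left_eq of_nat_Suc of_nat_mod mod_less)
      then show ?thesis unfolding c_def by (simp only: nat_int)
    qed
    then show "E (c i) (c (i + 1))" using f(3)[OF m] by (simp add: c_def)
  qed
  moreover have "c (i + int n) = c i" for i by (simp add: c_def)
  ultimately show ?thesis using n(1) f(1) by (intro exI[of _ c] exI[of _ n]) (auto simp: c_def)
qed

text \<open>The product of the individual periods works. A common period matters because
  \<open>insert_cycle\<close> moves the past by \<open>p\<close> also at places from which the
  marked vertex is too far away to be seen.\<close>

lemma closed_paths_common_period: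
  "\<exists>c p. 0 < p \<and> (\<forall>v. recurrent E v \<longrightarrow> c v \<in> paths E \<and> c v 0 = v \<and> (\<forall>i. c v (i + p) = c v i))"
proof -
  obtain c n where cn: "\<And>v. recurrent E v \<Longrightarrow> c v \<in> paths E" "\<And>v. recurrent E v \<Longrightarrow> c v 0 = v"
    "\<And>v. recurrent E v \<Longrightarrow> 0 < n v" "\<And>v i. recurrent E v \<Longrightarrow> c v (i + int (n v)) = c v i"
    using closed_path by metis
  have fin: "finite {v. recurrent E v}"
    using finite_vertices by (rule finite_subset[rotated]) (auto simp: recurrent_def dest: tranclpD)
  define p where "p = (\<Prod>v | recurrent E v. n v)"
  have "0 < p" unfolding p_def using cn(3) by (auto intro: prod_pos)
  moreover have "c v (i + int p) = c v i" if v: "recurrent E v" for v i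
  proof -
    have "n v dvd p" unfolding p_def by (rule dvd_prodI[OF fin]) (use v in simp)
    then obtain k where "p = n v * k" ..
    then show ?thesis using periodic_multiple[of "c v" "n v" i k] cn(4)[OF v] by simp
  qed
  ultimately show ?thesis
    using cn by (intro exI[of _ c] exI[of _ "int p"]) auto
qed

text \<open>Among \<open>card V + 1\<close> consecutive positions some vertex repeats, and a
  repeated vertex lies on a closed walk.\<close>

lemma long_path_recurrent:
  assumes "x \<in> paths E"
  shows "\<exists>l. k < l \<and> l \<le> k + int (card V) + 1 \<and> recurrent E (x l)"
proof -
  let ?I = "{k + 1..k + int (card V) + 1}"
  have "x ` ?I \<subseteq> V" using paths_vertex[OF assms] by auto
  then have "card (x ` ?I) \<le> card V" by (rule card_mono[OF finite_vertices])
  also have "\<dots> < card ?I" by simp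
  finally have "\<not> inj_on x ?I" by (rule pigeonhole)
  then obtain l m where lm: "l \<in> ?I" "m \<in> ?I" "l < m" "x l = x m"
    unfolding inj_on_def by (metis linorder_neqE)
  then have "recurrent E (x l)"
    using paths_reach_plus[OF assms lm(3)] by (simp add: recurrent_def)
  then show ?thesis using lm(1) by (intro exI[of _ l]) simp
qed

end

section \<open>An injective code inserting a cycle at the last recurrent vertex of
  \<open>D\<close>\<close>

locale cycle_insertion = finite_graph E for E :: "'v \<Rightarrow> 'v \<Rightarrow> bool" +
  fixes D :: "'v set" and c :: "'v \<Rightarrow> int \<Rightarrow> 'v" and p :: int
  assumes backward_closed: "E v w \<Longrightarrow> w \<in> D \<Longrightarrow> v \<in> D"
    and period_pos: "0 < p"
    and cycle_path: "recurrent E v \<Longrightarrow> c v \<in> paths E"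
    and cycle_base: "recurrent E v \<Longrightarrow> c v 0 = v"
    and cycle_period: "recurrent E v \<Longrightarrow> c v (i + p) = c v i"
begin

text \<open>Only entries from \<open>k\<close> onwards matter, so a mark survives every change of
  the past; this allows pasts to be exchanged in \<open>forced_left_tail\<close>.\<close>

definition mark :: "(int \<Rightarrow> 'v) \<Rightarrow> int \<Rightarrow> bool" where
  "mark x k \<longleftrightarrow> recurrent E (x k) \<and> x k \<in> D \<and> (\<forall>j>k. x j \<in> D \<longrightarrow> \<not> recurrent E (x j)) \<and> (\<exists>j>k. x j \<notin> D)"

text \<open>For paths, the unmarked cases are the limits of the marked one with the mark at plus
  infinity (path inside \<open>D\<close>, everything moved by \<open>p\<close>) and at minus
  infinity (path outside \<open>D\<close>, nothing changed). This is what makes the map a block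
  code.\<close>

definition insert_cycle :: "(int \<Rightarrow> 'v) \<Rightarrow> (int \<Rightarrow> 'v)" where
  "insert_cycle x =
    (if \<exists>k. mark x k then
       let k = THE k. mark x k
       in (\<lambda>i. if k \<le> i then x i else if k - p \<le> i then c (x k) (i - k) else x (i + p))
     else if \<forall>i. x i \<in> D then translate p x else x)"

lemma mark_unique: "mark x k \<Longrightarrow> mark x l \<Longrightarrow> k = l"
  unfolding mark_def by (metis linorder_neqE)

lemma mark_cong: "mark x k \<Longrightarrow> (\<And>i. k \<le> i \<Longrightarrow> y i = x i) \<Longrightarrow> mark y k"
  unfolding mark_def by (metis less_imp_le order_refl)

lemma insert_cycle_mark:
  assumes "mark x k"
  shows "insert_cycle x i = (if k \<le> i then x i else if k - p \<le> i then c (x k) (i - k) else x (i + p))"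
proof -
  have "(THE k. mark x k) = k" using assms mark_unique by blast
  then show ?thesis using assms by (auto simp: insert_cycle_def)
qed

lemma in_D_backward: "x \<in> paths E \<Longrightarrow> x j \<in> D \<Longrightarrow> i \<le> j \<Longrightarrow> x i \<in> D"
proof -
  assume x: "x \<in> paths E" "x j \<in> D" "i \<le> j"
  have "E\<^sup>*\<^sup>* v w \<Longrightarrow> w \<in> D \<Longrightarrow> v \<in> D" for v w
    by (induction rule: converse_rtranclp_induct) (auto dest: backward_closed)
  then show ?thesis using paths_reach[OF x(1,3)] x(2) by blast
qed

definition bound :: int where "bound = int (card V) + 1"

text \<open>Otherwise the path would meet a recurrent vertex among the next \<open>bound\<close>
  positions, still inside \<open>D\<close> by backward closure, contrary to the choice of the
  mark.\<close>

lemma mark_bound: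
  assumes "x \<in> paths E" "mark x k"
  shows "x (k + bound) \<notin> D"
proof
  assume D: "x (k + bound) \<in> D"
  obtain l where l: "k < l" "l \<le> k + bound" "recurrent E (x l)"
    using long_path_recurrent[OF assms(1), of k] by (auto simp: bound_def add.assoc)
  then have "x l \<in> D" using in_D_backward[OF assms(1) D] by blast
  then show False using l assms(2) by (auto simp: mark_def)
qed

lemma mark_exists:
  assumes x: "x \<in> paths E" and i: "x i \<in> D" and j: "x j \<notin> D"
  shows "\<exists>k. mark x k"
proof -
  have ij: "i < j" using in_D_backward[OF x i] j by (metis not_less)
  \<comment> \<open>Paths never return to \<open>D\<close>, so recurrent vertices in
    \<open>D\<close> occur only before \<open>j\<close>. The finite window therefore contains the
    last of them.\<close>
  let ?K = "{k. k \<le> j \<and> i - bound \<le> k \<and> x k \<in> D \<and> recurrent E (x k)}"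
  obtain l where l: "i - bound < l" "l \<le> i" "recurrent E (x l)"
    using long_path_recurrent[OF x, of "i - bound"] by (auto simp: bound_def)
  then have lK: "l \<in> ?K" using in_D_backward[OF x i] ij by auto
  have fin: "finite ?K" by (rule finite_subset[of _ "{i - bound..j}"]) auto
  have M: "Max ?K \<in> ?K" "l \<le> Max ?K"
    using Max_in[OF fin] Max_ge[OF fin lK] lK by blast+
  have "mark x (Max ?K)"
    unfolding mark_def
  proof (intro conjI allI impI)
    fix m assume m: "Max ?K < m" "x m \<in> D"
    show "\<not> recurrent E (x m)"
    proof
      assume "recurrent E (x m)"
      moreover have "m \<le> j" using in_D_backward[OF x m(2)] j by (metis linear)
      ultimately have "m \<in> ?K" using m M(2) l by auto
      then show False using Max_ge[OF fin] m(1) by fastforce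
    qed
  next
    have "Max ?K \<noteq> j" using M(1) j by auto
    then show "\<exists>m>Max ?K. x m \<notin> D" using M(1) j by (intro exI[of _ j]) auto
  qed (use M(1) in auto)
  then show ?thesis ..
qed

text \<open>From the mark onwards nothing changes, so the mark stays. A path without mark lies
  wholly inside or wholly outside \<open>D\<close>; so does its image, which then has no mark
  either.\<close>

lemma mark_insert_cycle_iff:
  assumes "x \<in> paths E"
  shows "mark (insert_cycle x) k \<longleftrightarrow> mark x k"
proof
  show "mark x k \<Longrightarrow> mark (insert_cycle x) k"
    by (rule mark_cong) (simp_all add: insert_cycle_mark)
  assume m: "mark (insert_cycle x) k"
  show "mark x k"
  proof (cases "\<exists>l. mark x l")
    case True
    then obtain l where l: "mark x l" ..
    then have "mark (insert_cycle x) l" by (rule mark_cong) (simp add: insert_cycle_mark[OF l])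
    then show ?thesis using m l mark_unique by blast
  next
    case False
    then have "(\<forall>i. x i \<in> D) \<or> (\<forall>i. x i \<notin> D)" using mark_exists[OF assms] by blast
    then have False using m False by (auto simp: insert_cycle_def mark_def translate_def split: if_splits)
    then show ?thesis ..
  qed
qed

lemma insert_cycle_path:
  assumes x: "x \<in> paths E"
  shows "insert_cycle x \<in> paths E"
proof (cases "\<exists>k. mark x k")
  case True
  then obtain k where k: "mark x k" ..
  then have r: "recurrent E (x k)" by (simp add: mark_def)
  note ins = insert_cycle_mark[OF k]
  \<comment> \<open>The two seams: at \<open>k - p\<close> the inserted cycle meets the moved past,
    at \<open>k\<close> the unchanged future, both times in the vertex \<open>x k\<close>.\<close>
  have c0: "c (x k) 0 = x k" and cp: "c (x k) (- p) = x k"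
    using cycle_base[OF r] cycle_period[OF r, of "- p"] by auto
  show ?thesis
    unfolding paths_def
  proof (intro CollectI allI)
    fix i
    consider "k \<le> i" | "k - p \<le> i" "i < k" | "i < k - p" by linarith
    then show "E (insert_cycle x i) (insert_cycle x (i + 1))"
    proof cases
      case 1
      then show ?thesis using paths_step[OF x] by (simp add: ins)
    next
      case 2
      then have "insert_cycle x (i + 1) = c (x k) (i - k + 1)"
        using c0 by (cases "i + 1 = k") (auto simp: ins algebra_simps)
      then show ?thesis using 2 paths_step[OF cycle_path[OF r], of "i - k"] by (simp add: ins)
    next
      case 3
      then have "insert_cycle x (i + 1) = x (i + p + 1)"
        using cp period_pos by (cases "i + 1 = k - p") (auto simp: ins algebra_simps)
      then show ?thesis using 3 period_pos paths_step[OF x, of "i + p"] by (simp add: ins)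
    qed
  qed
next
  case False
  then show ?thesis using x translate_paths[OF x] by (auto simp: insert_cycle_def)
qed

text \<open>Three cases can be told apart in the window at \<open>i\<close>. If \<open>x i\<close>
  is outside \<open>D\<close>, nothing changes there. If \<open>x (i + p + bound)\<close> is inside
  \<open>D\<close>, a mark can only lie beyond \<open>i + p\<close>, and the value is
  \<open>x (i + p)\<close>. Otherwise the mark lies between \<open>i - bound\<close> and
  \<open>i + p + bound\<close> and can be located.\<close>

lemma insert_cycle_code: "sliding_block_code (p + bound) (paths E) (paths E) insert_cycle"
proof (rule sliding_block_codeI)
  have bp: "0 < bound" by (simp add: bound_def)
  then show "0 \<le> p + bound" using period_pos by simp
  show "insert_cycle x \<in> paths E" if "x \<in> paths E" for x by (rule insert_cycle_path[OF that])
  have outside: "insert_cycle x i = x i" if "x \<in> paths E" "x i \<notin> D" for x i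
  proof (cases "\<exists>k. mark x k")
    case True
    then obtain k where k: "mark x k" ..
    then have "k \<le> i" using in_D_backward[OF that(1), of k i] that(2) by (meson linear mark_def)
    then show ?thesis by (simp add: insert_cycle_mark[OF k])
  qed (use that in \<open>auto simp: insert_cycle_def\<close>)
  have inside: "insert_cycle x i = x (i + p)" if x: "x \<in> paths E" and D: "x (i + p + bound) \<in> D" for x i
  proof (cases "\<exists>k. mark x k")
    case True
    then obtain k where k: "mark x k" ..
    have "i + p < k"
      using mark_bound[OF x k] in_D_backward[OF x D, of "k + bound"] by (metis add_le_cancel_right not_less)
    then show ?thesis using period_pos by (simp add: insert_cycle_mark[OF k])
  next
    case False
    then have "\<forall>i. x i \<in> D" using D mark_exists[OF x] by blast
    then show ?thesis using False by (simp add: insert_cycle_def translate_def)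
  qed
  fix x y i j assume x: "x \<in> paths E" and y: "y \<in> paths E"
    and "\<And>k. \<bar>k\<bar> \<le> p + bound \<Longrightarrow> x (i + k) = y (j + k)"
  then have eq: "x (i + k) = y (j + k)" if "- bound \<le> k" "k \<le> p + bound" for k
    using that period_pos bp by (simp add: abs_le_iff)
  have eq0: "x i = y j" and eqp: "x (i + p) = y (j + p)" "x (i + p + bound) = y (j + p + bound)"
    using eq[of 0] eq[of p] eq[of "p + bound"] bp period_pos by (auto simp: add.assoc)
  consider "x i \<notin> D" | "x (i + p + bound) \<in> D" | "x i \<in> D" "x (i + p + bound) \<notin> D" by blast
  then show "insert_cycle x i = insert_cycle y j"
  proof cases
    case 1
    then show ?thesis using outside[OF x] outside[OF y] eq0 by simp
  next
    case 2
    then show ?thesis using inside[OF x] inside[OF y] eqp by simp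
  next
    case 3
    then obtain k where k: "mark x k" using mark_exists[OF x] by blast
    have lo: "i - bound < k"
      using mark_bound[OF x k] in_D_backward[OF x 3(1), of "k + bound"] by (metis diff_less_eq not_less)
    have hi: "k < i + p + bound"
      using k 3(2) in_D_backward[OF x, of k "i + p + bound"] by (meson mark_def not_less)
    have eq': "x l = y (l - i + j)" if "k \<le> l" "l \<le> i + p + bound" for l
      using eq[of "l - i"] that lo by (simp add: algebra_simps)
    have m: "mark y (k - i + j)"
      unfolding mark_def
    proof (intro conjI allI impI)
      show "recurrent E (y (k - i + j))" "y (k - i + j) \<in> D"
        using k eq'[of k] hi by (auto simp: mark_def)
      show "\<exists>l>k - i + j. y l \<notin> D" using eqp(2) 3(2) hi by (intro exI[of _ "j + p + bound"]) auto
      \<comment> \<open>Whether this is the last recurrent vertex in \<open>D\<close> is decided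
        inside the window, because from \<open>j + p + bound\<close> on the path \<open>y\<close> is
        outside \<open>D\<close>.\<close>
      fix l assume l: "k - i + j < l" "y l \<in> D"
      have "l < j + p + bound"
        using in_D_backward[OF y l(2), of "j + p + bound"] 3(2) eqp(2) by (metis not_less)
      then have "x (l - j + i) = y l" using eq'[of "l - j + i"] l(1) by (simp add: algebra_simps)
      then show "\<not> recurrent E (y l)"
        using k l unfolding mark_def by (metis add.commute diff_add_eq diff_less_eq less_diff_eq)
    qed
    have kk: "x k = y (k - i + j)" using eq'[of k] hi by simp
    show ?thesis unfolding insert_cycle_mark[OF k] insert_cycle_mark[OF m]
      using kk eq0 eqp(1) by (auto simp: algebra_simps)
  qed
qed

text \<open>The image has the same mark, so the inserted segment can be located and removed. Without
  a mark the map is a translation or the identity, and membership in \<open>D\<close> tells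
  which.\<close>

lemma insert_cycle_inj: "inj_on insert_cycle (paths E)"
proof (rule inj_onI)
  fix x y assume x: "x \<in> paths E" and y: "y \<in> paths E" and eq: "insert_cycle x = insert_cycle y"
  show "x = y"
  proof (cases "\<exists>k. mark x k")
    case True
    then obtain k where k: "mark x k" ..
    then have l: "mark y k" using eq mark_insert_cycle_iff[OF x] mark_insert_cycle_iff[OF y] by simp
    have dec: "z i = (if k \<le> i then insert_cycle z i else insert_cycle z (i - p))" if "mark z k" for z i
      using that period_pos by (simp add: insert_cycle_mark)
    show ?thesis
    proof
      fix i show "x i = y i" using dec[OF k, of i] dec[OF l, of i] eq by simp
    qed
  next
    case False
    then have nm: "\<not> (\<exists>k. mark y k)"
      using eq mark_insert_cycle_iff[OF x] mark_insert_cycle_iff[OF y] by metis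
    have alt: "(\<forall>i. z i \<in> D) \<and> insert_cycle z = translate p z \<or> (\<forall>i. z i \<notin> D) \<and> insert_cycle z = z"
      if "z \<in> paths E" "\<not> (\<exists>k. mark z k)" for z
      using mark_exists[OF that(1)] that(2) by (auto simp: insert_cycle_def)
    have tinj: "u = w" if "translate p u = translate p w" for u w :: "int \<Rightarrow> 'v"
    proof
      fix i show "u i = w i" using fun_cong[OF that, of "i - p"] by (simp add: translate_def)
    qed
    show ?thesis
      using alt[OF x False] alt[OF y nm] eq tinj by (metis translate_def)
  qed
qed

text \<open>In the range of \<open>insert_cycle\<close> every mark is preceded by a full copy of the
  cycle. By surjectivity this holds for all paths, and repeating it from the vertex
  \<open>y k\<close> found one period earlier forces the entire past.\<close>

lemma forced_left_tail:
  assumes surj: "insert_cycle ` paths E = paths E" and y: "y \<in> paths E" and k: "mark y k" and "i \<le> k"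
  shows "y i = c (y k) (i - k)"
proof -
  have r: "recurrent E (y k)" using k by (simp add: mark_def)
  have one: "z (a + i) = c (y k) i" if z: "z \<in> paths E" "z a = y k" and i: "- p \<le> i" "i \<le> 0" for z a i
  proof -
    \<comment> \<open>A path \<open>z\<close> through the vertex \<open>y k\<close> is given the
      future of \<open>y\<close> and with it a mark at \<open>a\<close>. So the last
      \<open>p\<close> entries of \<open>z\<close> before \<open>a\<close> are forced even if
      \<open>z\<close> has no mark there.\<close>
    define w where "w j = (if j \<le> a then z j else y (j - a + k))" for j
    have w: "w \<in> paths E" unfolding w_def using paths_splice[OF z(1) y z(2)] .
    have "mark (translate (a - k) w) k"
      by (rule mark_cong[OF k]) (use z(2) in \<open>auto simp: translate_def w_def\<close>)
    moreover have "translate (a - k) w \<in> insert_cycle ` paths E"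
      unfolding surj by (rule translate_paths[OF w])
    then obtain x where x: "x \<in> paths E" "insert_cycle x = translate (a - k) w" by (metis imageE)
    ultimately have m: "mark x k" using mark_insert_cycle_iff by metis
    have wk: "w (j + (a - k)) = (if k \<le> j then x j else if k - p \<le> j then c (x k) (j - k) else x (j + p))" for j
      using insert_cycle_mark[OF m, of j] x(2) by (simp add: translate_def)
    have xk: "x k = y k" using wk[of k] z(2) by (simp add: w_def)
    have "w (a + i) = c (y k) i"
      using wk[of "k + i"] i xk cycle_base[OF r] by (cases "i = 0") (auto simp: algebra_simps)
    then show ?thesis using i by (simp add: w_def)
  qed
  \<comment> \<open>Each return to \<open>y k\<close> provides the next position at which
    \<open>one\<close> applies to \<open>y\<close> itself.\<close>
  have return: "y (k - int n * p) = y k" for n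
  proof (induction n)
    case (Suc n)
    have "y (k - int n * p + (- p)) = c (y k) (- p)"
      by (rule one[OF y Suc]) (use period_pos in auto)
    also have "\<dots> = y k" using cycle_period[OF r, of "- p"] cycle_base[OF r] by simp
    finally show ?case by (simp add: algebra_simps)
  qed simp
  have per: "c (y k) (j - int n * p) = c (y k) j" for n j
  proof (induction n)
    case (Suc n)
    then show ?case using cycle_period[OF r, of "j - int n * p - p"] by (simp add: algebra_simps)
  qed simp
  define n m where "n = nat ((k - i) div p)" and "m = (k - i) mod p"
  have m: "0 \<le> m" "m < p" using period_pos by (auto simp: m_def)
  have "int n = (k - i) div p"
    unfolding n_def using \<open>i \<le> k\<close> period_pos by (simp add: pos_imp_zdiv_nonneg_iff)
  then have ki: "k - i = int n * p + m" by (simp add: m_def)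
  have "y (k - int n * p + (- m)) = c (y k) (- m)"
    by (rule one[OF y return]) (use m in auto)
  moreover have "k - int n * p + (- m) = i" "- m - int n * p = i - k" using ki by auto
  ultimately show ?thesis using per[of "- m" n] by metis
qed

end

section \<open>Counting words in strongly connected graphs\<close>

definition block :: "(int \<Rightarrow> 'v) \<Rightarrow> nat \<Rightarrow> 'v list" where
  "block x n = map (\<lambda>t. x (int t)) [0..<n]"

definition occurs :: "'v list \<Rightarrow> 'v list \<Rightarrow> nat \<Rightarrow> bool" where
  "occurs u w t \<longleftrightarrow> t + length u \<le> length w \<and> (\<forall>s<length u. w ! (t + s) = u ! s)"

lemma length_block [simp]: "length (block x n) = n"
  by (simp add: block_def)

lemma nth_block [simp]: "t < n \<Longrightarrow> block x n ! t = x (int t)"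
  by (simp add: block_def)

lemma block_eq_iff: "block x n = block y n \<longleftrightarrow> (\<forall>t<n. x (int t) = y (int t))"
  by (auto simp: list_eq_iff_nth_eq)

lemma take_block: "a \<le> n \<Longrightarrow> take a (block x n) = block x a"
  by (simp add: list_eq_iff_nth_eq)

lemma drop_block: "drop a (block x n) = block (translate (int a) x) (n - a)"
  by (simp add: list_eq_iff_nth_eq translate_def add.commute)

lemma inj_on_take_drop: "inj_on (\<lambda>w. (take a w, drop a w)) S"
  by (rule inj_onI) (metis append_take_drop_id prod.inject)

lemma lexn_intro:
  assumes "length w = n" "length w' = n" "i < n" "\<And>j. j < i \<Longrightarrow> w ! j = w' ! j" "(w ! i, w' ! i) \<in> R"
  shows "(w, w') \<in> lexn R n"
proof -
  have "take i w = take i w'" using assms by (simp add: list_eq_iff_nth_eq)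
  then show ?thesis
    unfolding lexn_conv using assms id_take_nth_drop[of i w] id_take_nth_drop[of i w']
    by (intro CollectI case_prodI) metis
qed

context finite_graph
begin

text \<open>Words are read at position 0; \<open>paths E\<close> is closed under translation, so
  these are the words occurring anywhere.\<close>

definition lang :: "nat \<Rightarrow> 'v list set" where
  "lang n = (\<lambda>x. block x n) ` paths E"

definition avoiding :: "'v list \<Rightarrow> nat \<Rightarrow> 'v list set" where
  "avoiding u n = {w \<in> lang n. \<forall>t. \<not> occurs u w t}"

lemma finite_lang: "finite (lang n)"
  by (rule finite_subset[OF _ finite_lists_length_eq[OF finite_vertices, of n]])
    (use paths_vertex in \<open>fastforce simp: lang_def block_def\<close>)

lemma finite_avoiding: "finite (avoiding u n)"
  using finite_lang by (simp add: avoiding_def)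

lemma take_lang: "w \<in> lang (a + b) \<Longrightarrow> take a w \<in> lang a"
  and drop_lang: "w \<in> lang (a + b) \<Longrightarrow> drop a w \<in> lang b"
  by (auto simp: lang_def take_block drop_block translate_paths)

lemma card_lang_add: "card (lang (a + b)) \<le> card (lang a) * card (lang b)"
  unfolding card_cartesian_product[symmetric]
  by (rule card_inj_on_le[OF inj_on_take_drop[of a]])
    (auto simp: finite_lang take_lang drop_lang)

lemma card_avoiding_add: "card (avoiding u (a + b)) \<le> card (avoiding u a) * card (lang b)"
  unfolding card_cartesian_product[symmetric]
proof (rule card_inj_on_le[OF inj_on_take_drop[of a]])
  have "occurs u w t" if "occurs u (take a w) t" for w t
    using that by (auto simp: occurs_def)
  then show "(\<lambda>w. (take a w, drop a w)) ` avoiding u (a + b) \<subseteq> avoiding u a \<times> lang b"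
    by (auto simp: avoiding_def take_lang drop_lang)
qed (simp add: finite_lang finite_avoiding)

lemma connection_bound:
  assumes irr: "\<And>a b. a \<in> V \<Longrightarrow> b \<in> V \<Longrightarrow> E\<^sup>*\<^sup>* a b"
  obtains g where "\<And>a b. a \<in> V \<Longrightarrow> b \<in> V \<Longrightarrow> \<exists>q\<le>g. (E ^^ q) a b"
proof -
  have "\<forall>s\<in>V \<times> V. \<exists>q. (E ^^ q) (fst s) (snd s)"
    using irr by (auto simp: rtranclp_power)
  then obtain q where q: "\<And>s. s \<in> V \<times> V \<Longrightarrow> (E ^^ q s) (fst s) (snd s)"
    using bchoice[of "V \<times> V" "\<lambda>s q. (E ^^ q) (fst s) (snd s)"] by blast
  have fin: "finite (V \<times> V)" using finite_vertices by blast
  show ?thesis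
  proof (rule that)
    fix a b assume "a \<in> V" "b \<in> V"
    then have s: "(a, b) \<in> V \<times> V" by simp
    show "\<exists>n\<le>Max (q ` (V \<times> V)). (E ^^ n) a b"
      using q[OF s] Max_ge[OF finite_imageI[OF fin] imageI[OF s]] by auto
  qed
qed

text \<open>Sort the words that contain \<open>u\<close> by its first occurrence: a word avoiding \<open>u\<close> can be
  continued by \<open>u\<close> and then by an arbitrary word, up to connecting paths of bounded length.\<close>

lemma sum_avoiding_bound:
  assumes irr: "\<And>a b. a \<in> V \<Longrightarrow> b \<in> V \<Longrightarrow> E\<^sup>*\<^sup>* a b"
    and u: "u \<in> lang m" and m: "0 < m"
  shows "\<exists>K. \<forall>n. (\<Sum>j = 1..<n. card (avoiding u j) * card (lang (n - j))) \<le> K * card (lang n)"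
proof -
  obtain g where g: "\<And>a b. a \<in> V \<Longrightarrow> b \<in> V \<Longrightarrow> \<exists>q\<le>g. (E ^^ q) a b"
    using connection_bound[OF irr] by blast
  obtain d where d: "d \<in> paths E" "u = block d m" using u by (auto simp: lang_def)
  have lu: "length u = m" using d by simp
  define first where "first w = (LEAST t. occurs u w t)" for w
  let ?G = "2 * g + m"
  have "(\<Sum>j = 1..<n. card (avoiding u j) * card (lang (n - j)))
      \<le> (g + 1) * (g + 1) * (g + m) * card (lang ?G) * card (lang n)" for n
  proof -
    let ?S = "Sigma {1..<n} (\<lambda>j. avoiding u j \<times> lang (n - j))"
    let ?T = "{..g} \<times> {..g} \<times> {..<g + m} \<times> lang (n + ?G)"
    \<comment> \<open>Each triple in \<open>?S\<close> is decoded from one longer word and boundedly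
      many parameters: \<open>q1\<close> and \<open>q2\<close> are the lengths of the connecting
      walks, and \<open>e\<close> is the offset of \<open>j\<close> from the first occurrence of
      \<open>u\<close>, raised by \<open>g\<close> to stay a natural number.\<close>
    define dec where "dec = (\<lambda>(q1, q2, e, w).
      let j = e + first w - g in (j, take j w, take (n - j) (drop (j - 1 + q1 + (m - 1) + q2) w)))"
    have "?S \<subseteq> dec ` ?T"
    proof
      fix s assume "s \<in> ?S"
      then obtain j w1 w2 where s: "s = (j, w1, w2)" and j: "1 \<le> j" "j < n"
        and w1: "w1 \<in> avoiding u j" and w2: "w2 \<in> lang (n - j)" by auto
      obtain x where x: "x \<in> paths E" "w1 = block x j" using w1 by (auto simp: avoiding_def lang_def)
      obtain y where y: "y \<in> paths E" "w2 = block y (n - j)" using w2 by (auto simp: lang_def)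
      \<comment> \<open>The walks start at the last letter of \<open>w1\<close>, position
        \<open>j - 1\<close>, and at the last letter of \<open>u\<close>; this explains the offsets
        by one. With a walk of length 0 two pieces share a letter.\<close>
      obtain q1 where q1: "q1 \<le> g" "(E ^^ q1) (x (int (j - 1))) (d 0)"
        using g paths_vertex[OF x(1)] paths_vertex[OF d(1)] by blast
      obtain z1 where z1: "z1 \<in> paths E" "\<And>i. i \<le> int (j - 1) \<Longrightarrow> z1 i = x i"
        "\<And>i. 0 \<le> i \<Longrightarrow> z1 (int (j - 1) + int q1 + i) = d (0 + i)"
        using paths_connect[OF x(1) d(1) q1(2)] by blast
      let ?p = "j - 1 + q1"
      obtain q2 where q2: "q2 \<le> g" "(E ^^ q2) (z1 (int (?p + (m - 1)))) (y 0)"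
        using g paths_vertex[OF z1(1)] paths_vertex[OF y(1)] by blast
      obtain z where z: "z \<in> paths E" "\<And>i. i \<le> int (?p + (m - 1)) \<Longrightarrow> z i = z1 i"
        "\<And>i. 0 \<le> i \<Longrightarrow> z (int (?p + (m - 1)) + int q2 + i) = y (0 + i)"
        using paths_connect[OF z1(1) y(1) q2(2)] by blast
      define w where "w = block z (n + ?G)"
      have w: "w \<in> lang (n + ?G)" using z(1) by (auto simp: w_def lang_def)
      have wt: "w ! t = z (int t)" if "t < n + ?G" for t using that by (simp add: w_def)
      have lw: "length w = n + ?G" by (simp add: w_def)
      have t1: "take j w = w1"
        unfolding w_def x(2) using j z z1 by (subst take_block) (auto simp: block_eq_iff)
      have "z (int (?p + (m - 1) + q2 + t)) = y (int t)" for t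
        using z(3)[of "int t"] by (simp add: algebra_simps)
      then have t2: "take (n - j) (drop (?p + (m - 1) + q2) w) = w2"
        unfolding w_def y(2) drop_block using j q1 q2 m
        by (subst take_block) (auto simp: block_eq_iff translate_def algebra_simps)
      have occ: "occurs u w ?p"
        unfolding occurs_def lu lw
      proof (intro conjI allI impI)
        show "?p + m \<le> n + ?G" using j q1 by simp
        fix t assume t: "t < m"
        then have "w ! (?p + t) = z1 (int (?p + t))"
          using wt[of "?p + t"] z(2)[of "int (?p + t)"] j q1 by simp
        also have "\<dots> = d (int t)" using z1(3)[of "int t"] by (simp add: algebra_simps)
        finally show "w ! (?p + t) = u ! t" using t d(2) by simp
      qed
      then have fo: "occurs u w (first w)" and fle: "first w \<le> ?p"
        unfolding first_def by (auto intro: LeastI Least_le)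
      \<comment> \<open>The first occurrence cannot end within the first \<open>j\<close> letters,
        which avoid \<open>u\<close>. Together with \<open>fle\<close> this leaves at most
        \<open>g + m\<close> offsets.\<close>
      have fge: "j < first w + m"
      proof (rule ccontr)
        assume "\<not> j < first w + m"
        then have "occurs u (take j w) (first w)" using fo lu by (auto simp: occurs_def)
        then show False using w1 t1 by (auto simp: avoiding_def)
      qed
      let ?e = "j + g - first w"
      have e: "?e < g + m" "?e + first w - g = j" using fle fge q1 j by auto
      have "dec (q1, q2, ?e, w) = s"
        unfolding dec_def s using t1 t2 e(2) by (simp add: Let_def)
      moreover have "(q1, q2, ?e, w) \<in> ?T" using q1 q2 e w by simp
      ultimately show "s \<in> dec ` ?T" by (metis imageI)
    qed
    then have "card ?S \<le> card ?T"
      by (rule surj_card_le[rotated]) (simp add: finite_lang)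
    also have "\<dots> = (g + 1) * (g + 1) * (g + m) * card (lang (?G + n))"
      by (simp only: card_cartesian_product card_atMost card_lessThan add.commute[of n] mult.assoc Suc_eq_plus1)
    also have "\<dots> \<le> (g + 1) * (g + 1) * (g + m) * (card (lang ?G) * card (lang n))"
      by (intro mult_le_mono card_lang_add order_refl)
    also have "card ?S = (\<Sum>j = 1..<n. card (avoiding u j) * card (lang (n - j)))"
      by (subst card_SigmaI) (auto simp: finite_lang finite_avoiding card_cartesian_product)
    finally show ?thesis by (simp only: mult.assoc)
  qed
  then show ?thesis by blast
qed

text \<open>The exchanged block has margins of width \<open>2 * r + 1\<close> around the places
  where \<open>x\<close> and \<open>y\<close> may differ. A window of radius \<open>r\<close> either
  lies inside the block, where \<open>\<tau> x = \<tau> y\<close> applies, or misses all places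
  where \<open>z'\<close> and \<open>z\<close> differ.\<close>

lemma diamond_exchange:
  assumes code: "sliding_block_code r (paths E) (paths E) \<tau>"
    and x: "x \<in> paths E" and y: "y \<in> paths E" and eq: "\<tau> x = \<tau> y"
    and agree: "\<And>i. s < \<bar>i\<bar> \<Longrightarrow> x i = y i" and s: "0 \<le> s"
    and a: "a = - s - 2 * r - 1" and m: "m = 2 * s + 4 * r + 3"
    and z: "z \<in> paths E" and occ: "\<And>i. 0 \<le> i \<Longrightarrow> i < m \<Longrightarrow> z (t + i) = x (a + i)"
    and z': "\<And>i. z' i = (if t \<le> i \<and> i < t + m then y (i - t + a) else z i)"
  shows "z' \<in> paths E" "\<tau> z' = \<tau> z"
proof -
  have r: "0 \<le> r" by (rule sliding_block_code_nonneg[OF code])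
  have zx: "z i = x (i - t + a)" if "t \<le> i" "i < t + m" for i
    using occ[of "i - t"] that by (simp add: algebra_simps)
  have same: "z' i = z i" if "s < \<bar>i - t + a\<bar>" for i
    using agree[OF that] zx[of i] by (auto simp: z')
  show paths: "z' \<in> paths E"
    unfolding paths_def
  proof (intro CollectI allI)
    fix i
    show "E (z' i) (z' (i + 1))"
    proof (cases "t \<le> i \<and> i + 1 < t + m")
      case True
      then have "z' i = y (i - t + a)" "z' (i + 1) = y (i - t + a + 1)" by (auto simp: z' algebra_simps)
      then show ?thesis using paths_step[OF y] by simp
    next
      case False
      then have "z' i = z i" "z' (i + 1) = z (i + 1)"
        using a m r s by (auto intro!: same)
      then show ?thesis using paths_step[OF z] by simp
    qed
  qed
  show "\<tau> z' = \<tau> z"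
  proof
    fix j
    show "\<tau> z' j = \<tau> z j"
    proof (cases "t + r \<le> j \<and> j < t + m - r")
      case True
      have "\<tau> z' j = \<tau> y (j - t + a)"
        by (rule sliding_block_code_eq[OF code paths y]) (use True in \<open>auto simp: z' algebra_simps\<close>)
      also have "\<dots> = \<tau> x (j - t + a)" using eq by simp
      also have "\<dots> = \<tau> z j"
      proof (rule sliding_block_code_eq[OF code x z])
        fix k :: int assume "\<bar>k\<bar> \<le> r"
        then show "x (j - t + a + k) = z (j + k)" using zx[of "j + k"] True by (auto simp: algebra_simps)
      qed
      finally show ?thesis .
    next
      case False
      show ?thesis
      proof (rule sliding_block_code_eq[OF code paths z])
        fix k :: int assume "\<bar>k\<bar> \<le> r"
        then show "z' (j + k) = z (j + k)" using False a m r s by (intro same) auto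
      qed
    qed
  qed
qed

text \<open>A counting argument in place of entropy. Every word of length \<open>n\<close> is the
  image of a slightly longer word avoiding \<open>u\<close>, so \<open>card (lang n)\<close> is at
  most a constant times \<open>card (avoiding u n)\<close>. Summing over the splittings of
  \<open>n\<close> contradicts \<open>sum_avoiding_bound\<close> once \<open>n\<close> is
  large.\<close>

theorem irreducible_moore:
  assumes irr: "\<And>a b. a \<in> V \<Longrightarrow> b \<in> V \<Longrightarrow> E\<^sup>*\<^sup>* a b"
    and code: "sliding_block_code r (paths E) (paths E) \<tau>" and surj: "\<tau> ` paths E = paths E"
    and x: "x \<in> paths E" and y: "y \<in> paths E" and hom: "homoclinic x y" and eq: "\<tau> x = \<tau> y"
  shows "x = y"
proof (rule ccontr)
  assume "x \<noteq> y"
  have r: "0 \<le> r" by (rule sliding_block_code_nonneg[OF code])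
  define s where "s = Max ((\<lambda>i. \<bar>i\<bar>) ` {i. x i \<noteq> y i})"
  have fin: "finite ((\<lambda>i. \<bar>i\<bar>) ` {i. x i \<noteq> y i})" using hom by (simp add: homoclinic_def)
  have differ: "\<bar>i\<bar> \<le> s" if "x i \<noteq> y i" for i
    unfolding s_def using fin that by (intro Max_ge) auto
  then have agree: "x i = y i" if "s < \<bar>i\<bar>" for i using that by force
  obtain i0 where i0: "x i0 \<noteq> y i0" using \<open>x \<noteq> y\<close> by auto
  then have s: "0 \<le> s" using differ by force
  define a where "a = - s - 2 * r - 1"
  define m where "m = nat (2 * s + 4 * r + 3)"
  have m: "int m = 2 * s + 4 * r + 3" "0 < m" using r s by (auto simp: m_def)
  define u where "u = block (translate a x) m"
  define v where "v = block (translate a y) m"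
  have u: "u \<in> lang m" using translate_paths[OF x] by (auto simp: u_def lang_def)
  have un: "u ! t = x (a + int t)" and vn: "v ! t = y (a + int t)" if "t < m" for t
    using that by (auto simp: u_def v_def translate_def add.commute)
  define e where "e = (LEAST t. t < m \<and> u ! t \<noteq> v ! t)"
  have "nat (i0 - a) < m" "a + int (nat (i0 - a)) = i0" using differ[OF i0] m r by (auto simp: a_def)
  then have "nat (i0 - a) < m \<and> u ! nat (i0 - a) \<noteq> v ! nat (i0 - a)" using i0 by (simp add: un vn)
  then have e: "e < m" "u ! e \<noteq> v ! e" unfolding e_def
    using LeastI[of "\<lambda>t. t < m \<and> u ! t \<noteq> v ! t"] by blast+
  have e_min: "u ! t = v ! t" if "t < e" for t
    using not_less_Least[of t "\<lambda>t. t < m \<and> u ! t \<noteq> v ! t"] that e(1) by (auto simp: e_def)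
  \<comment> \<open>Replacing \<open>u\<close> by \<open>v\<close> may create new occurrences of \<open>u\<close>, but it decreases the lexicographic
    order induced by \<open>R\<close>, so a minimal preimage avoids \<open>u\<close>.\<close>
  define R where "R = {(v ! e, u ! e)}"
  have "wf R" unfolding R_def using e(2) by (auto intro!: wf_no_loop simp: relcomp_unfold)
  let ?r = "nat r"
  define good where "good z n x' \<longleftrightarrow> x' \<in> paths E \<and> block (\<tau> x') n = block z n" for z n x'
  \<comment> \<open>The word of a preimage is widened by \<open>r\<close> on both sides, so that it
    determines the first \<open>n\<close> letters from position 0 of the image.\<close>
  define word where "word n x' = block (translate (- r) x') (n + 2 * ?r)" for n and x' :: "int \<Rightarrow> 'v"
  have word_nth: "word n x' ! t = x' (int t - r)" if "t < n + 2 * ?r" for n x' t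
    using that by (simp add: word_def translate_def)
  have avoid: "\<exists>x'. good z n x' \<and> word n x' \<in> avoiding u (n + 2 * ?r)" if z: "z \<in> paths E" for z n
  proof -
    have "z \<in> \<tau> ` paths E" using z surj by simp
    then obtain x0 where x0: "x0 \<in> paths E" "z = \<tau> x0" by blast
    let ?C = "word n ` {x'. good z n x'}"
    have "word n x0 \<in> ?C" using x0 by (simp add: good_def)
    then obtain w where w: "w \<in> ?C" "\<And>w'. (w', w) \<in> lexn R (n + 2 * ?r) \<Longrightarrow> w' \<notin> ?C"
      using wfE_min[OF wf_lexn[OF \<open>wf R\<close>]] by metis
    then obtain x' where x': "good z n x'" "w = word n x'" by auto
    then have x'p: "x' \<in> paths E" by (simp add: good_def)
    have "\<not> occurs u w t" for t
    proof
      assume occ: "occurs u w t"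
      have lw: "length w = n + 2 * ?r" "length u = m" by (simp_all add: x'(2) word_def u_def)
      then have tm: "t + m \<le> n + 2 * ?r" using occ by (simp add: occurs_def)
      have at: "x' (int t - r + i) = x (a + i)" if "0 \<le> i" "i < int m" for i
      proof -
        define k where "k = nat i"
        have k: "i = int k" "k < m" using that by (auto simp: k_def)
        have "x' (int (t + k) - r) = u ! k"
          using occ lw k(2) tm word_nth[of "t + k" n x'] by (simp add: occurs_def x'(2))
        then show ?thesis using un[OF k(2)] k(1) by (simp add: algebra_simps)
      qed
      define z' where "z' i = (if int t - r \<le> i \<and> i < int t - r + int m
        then y (i - (int t - r) + a) else x' i)" for i
      have z': "z' \<in> paths E" "\<tau> z' = \<tau> x'"
        using diamond_exchange[OF code x y eq agree s a_def m(1) x'p at z'_def] by auto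
      have "word n z' \<in> ?C" using x'(1) z' by (simp add: good_def)
      moreover have "(word n z', w) \<in> lexn R (n + 2 * ?r)"
      proof (rule lexn_intro[where i = "t + e"])
        show "t + e < n + 2 * ?r" using tm e(1) by simp
        have in_v: "word n z' ! (t + k) = v ! k" if "k < m" for k
          using that tm by (simp add: word_nth z'_def vn algebra_simps)
        have in_u: "w ! (t + k) = u ! k" if "k < m" for k
          using that occ lw by (simp add: occurs_def)
        show "(word n z' ! (t + e), w ! (t + e)) \<in> R" using e(1) by (simp add: in_v in_u R_def)
        show "word n z' ! j = w ! j" if j: "j < t + e" for j
        proof (cases "j < t")
          case True
          then show ?thesis using tm by (simp add: x'(2) word_nth z'_def)
        next
          case False
          then have "j = t + (j - t)" "j - t < e" using j by auto
          then show ?thesis using in_v[of "j - t"] in_u[of "j - t"] e_min[of "j - t"] e(1) by simp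
        qed
      qed (simp_all add: lw word_def)
      ultimately show False using w(2) by blast
    qed
    moreover have "w \<in> lang (n + 2 * ?r)"
      using translate_paths[OF x'p] by (auto simp: x'(2) word_def lang_def)
    ultimately show ?thesis using x' by (auto simp: avoiding_def)
  qed
  \<comment> \<open>Preimages of different words have different widened words; cutting off the
    \<open>2 * ?r\<close> additional letters costs a constant factor.\<close>
  have card_le: "card (lang n) \<le> card (avoiding u n) * card (lang (2 * ?r))" for n
  proof -
    have "\<forall>w\<in>lang n. \<exists>x'. x' \<in> paths E \<and> block (\<tau> x') n = w \<and> word n x' \<in> avoiding u (n + 2 * ?r)"
      using avoid by (fastforce simp: lang_def good_def)
    then obtain f where f: "\<And>w. w \<in> lang n \<Longrightarrow> f w \<in> paths E"
      "\<And>w. w \<in> lang n \<Longrightarrow> block (\<tau> (f w)) n = w"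
      "\<And>w. w \<in> lang n \<Longrightarrow> word n (f w) \<in> avoiding u (n + 2 * ?r)" by metis
    have "card (lang n) \<le> card (avoiding u (n + 2 * ?r))"
    proof (rule card_inj_on_le[where f = "\<lambda>w. word n (f w)"])
      show "inj_on (\<lambda>w. word n (f w)) (lang n)"
      proof (rule inj_onI)
        fix w w' assume w: "w \<in> lang n" and w': "w' \<in> lang n" and eq: "word n (f w) = word n (f w')"
        have "\<tau> (f w) (int t) = \<tau> (f w') (int t)" if t: "t < n" for t
        proof (rule sliding_block_code_eq[OF code f(1)[OF w] f(1)[OF w']])
          fix k :: int assume k: "\<bar>k\<bar> \<le> r"
          let ?j = "nat (int t + k + r)"
          have j: "?j < n + 2 * ?r" "int ?j - r = int t + k" using k t r by auto
          show "f w (int t + k) = f w' (int t + k)"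
            using word_nth[OF j(1), of "f w"] word_nth[OF j(1), of "f w'"] eq j(2) by simp
        qed
        then have "block (\<tau> (f w)) n = block (\<tau> (f w')) n" by (simp add: block_eq_iff)
        then show "w = w'" using f(2) w w' by metis
      qed
    qed (use f(3) finite_avoiding in auto)
    also have "\<dots> \<le> card (avoiding u n) * card (lang (2 * ?r))" by (rule card_avoiding_add)
    finally show ?thesis .
  qed
  obtain K where K: "\<And>n. (\<Sum>j = 1..<n. card (avoiding u j) * card (lang (n - j))) \<le> K * card (lang n)"
    using sum_avoiding_bound[OF irr u m(2)] by blast
  define C where "C = card (lang (2 * ?r))"
  \<comment> \<open>Large enough that \<open>n - 1\<close>, the number of splittings of
    \<open>n\<close>, exceeds \<open>C * K\<close>.\<close>
  define n where "n = C * K + 2"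
  have "(n - 1) * card (lang n) = (\<Sum>j = 1..<n. card (lang n))" by simp
  also have "\<dots> \<le> (\<Sum>j = 1..<n. C * (card (avoiding u j) * card (lang (n - j))))"
  proof (rule sum_mono)
    fix j assume "j \<in> {1..<n}"
    then have "card (lang n) \<le> card (lang j) * card (lang (n - j))"
      using card_lang_add[of j "n - j"] by simp
    also have "\<dots> \<le> card (avoiding u j) * C * card (lang (n - j))"
      using card_le[of j] by (simp add: C_def)
    finally show "card (lang n) \<le> C * (card (avoiding u j) * card (lang (n - j)))" by (simp add: ac_simps)
  qed
  also have "\<dots> \<le> C * (K * card (lang n))"
    using K[of n] by (simp add: sum_distrib_left[symmetric])
  finally have "(C * K + 1) * card (lang n) \<le> C * K * card (lang n)" by (simp add: n_def)
  then have "card (lang n) = 0" by simp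
  then show False using x finite_lang[of n] by (auto simp: lang_def)
qed

end

section \<open>Wandering paths\<close>

text \<open>The form in which the Myhill property is carried over to the graph: injective codes are
  pre-injective, and recoding preserves both injectivity and surjectivity.\<close>

definition surjunctive :: "(int \<Rightarrow> 'v) set \<Rightarrow> bool" where
  "surjunctive X \<longleftrightarrow> (\<forall>r \<tau>. sliding_block_code r X X \<tau> \<longrightarrow> inj_on \<tau> X \<longrightarrow> \<tau> ` X = X)"

definition reflect :: "(int \<Rightarrow> 'v) \<Rightarrow> (int \<Rightarrow> 'v)" where
  "reflect x = (\<lambda>i. x (- i))"

definition orbit :: "(int \<Rightarrow> 'v) \<Rightarrow> (int \<Rightarrow> 'v) set" where
  "orbit x = range (\<lambda>k. translate k x)"

text \<open>The other paths are those that stay in a single strongly connected component, so these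
  are the paths that pass from one component to another.\<close>

definition wandering :: "('v \<Rightarrow> 'v \<Rightarrow> bool) \<Rightarrow> (int \<Rightarrow> 'v) set" where
  "wandering E = {x \<in> paths E. \<exists>i j. \<not> E\<^sup>*\<^sup>* (x i) (x j)}"

lemma reflect_reflect [simp]: "reflect (reflect x) = x"
  by (simp add: reflect_def)

lemma translate_translate: "translate k (translate l x) = translate (k + l) x"
  by (simp add: translate_def add.assoc)

lemma translate_0: "translate 0 x = x"
  by (simp add: translate_def)

lemma orbit_translate: "orbit (translate k x) = orbit x"
proof -
  have "translate l x = translate (l - k) (translate k x)" for l by (simp add: translate_translate)
  then have "orbit x \<subseteq> orbit (translate k x)" unfolding orbit_def by blast
  then show ?thesis by (auto simp: orbit_def translate_translate)
qed

lemma reflect_paths: "reflect ` paths E = paths E\<inverse>\<inverse>"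
proof -
  have "reflect x \<in> paths F\<inverse>\<inverse>" if "x \<in> paths F" for x :: "int \<Rightarrow> 'a" and F
    unfolding paths_def reflect_def
  proof (intro CollectI allI)
    fix i show "F\<inverse>\<inverse> (x (- i)) (x (- (i + 1)))"
      using paths_step[OF that, of "- (i + 1)"] by simp
  qed
  from this[where F = E] this[where F = "E\<inverse>\<inverse>"] show ?thesis
    by (force intro: image_eqI[of _ reflect "reflect _"])
qed

text \<open>Conjugation by the reflection keeps the radius and injectivity. Applied to the reversed
  graph, the result on left tails then yields right tails.\<close>

lemma surjunctive_reflect:
  assumes "surjunctive X"
  shows "surjunctive (reflect ` X)"
  unfolding surjunctive_def
proof (intro allI impI)
  fix r \<tau> assume code: "sliding_block_code r (reflect ` X) (reflect ` X) \<tau>" and inj: "inj_on \<tau> (reflect ` X)"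
  let ?t = "\<lambda>x. reflect (\<tau> (reflect x))"
  have "sliding_block_code r X X ?t"
  proof (rule sliding_block_codeI)
    show "?t x \<in> X" if "x \<in> X" for x
      using sliding_block_code_in[OF code, of "reflect x"] that by auto
    fix x y i j assume x: "x \<in> X" and y: "y \<in> X" and eq: "\<And>k. \<bar>k\<bar> \<le> r \<Longrightarrow> x (i + k) = y (j + k)"
    have "\<tau> (reflect x) (- i) = \<tau> (reflect y) (- j)"
    proof (rule sliding_block_code_eq[OF code imageI[OF x] imageI[OF y]])
      fix k :: int assume "\<bar>k\<bar> \<le> r"
      then show "reflect x (- i + k) = reflect y (- j + k)"
        using eq[of "- k"] by (simp add: reflect_def)
    qed
    then show "?t x i = ?t y j" by (simp add: reflect_def)
  qed (rule sliding_block_code_nonneg[OF code])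
  moreover have "inj_on ?t X"
  proof (rule inj_onI)
    fix x y assume x: "x \<in> X" and y: "y \<in> X" and "?t x = ?t y"
    then have "\<tau> (reflect x) = \<tau> (reflect y)" by (metis reflect_reflect)
    then have "reflect x = reflect y" using inj x y by (meson imageI inj_onD)
    then show "x = y" by (metis reflect_reflect)
  qed
  ultimately have "?t ` X = X" using assms unfolding surjunctive_def by blast
  then have "reflect ` ?t ` X = reflect ` X" by simp
  then show "\<tau> ` reflect ` X = reflect ` X" by (simp add: image_image)
qed

lemma reach_in_paths:
  assumes "x \<in> paths E" "E\<^sup>*\<^sup>* (x j) v" "i \<le> j"
  shows "E\<^sup>*\<^sup>* (x i) v"
  using paths_reach[OF assms(1,3)] assms(2) by (rule rtranclp_trans)

section \<open>Forced tails and finiteness of the wandering orbits\<close>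

context finite_graph
begin

text \<open>The function \<open>c\<close> is chosen before \<open>D\<close> and the path, so the
  past up to \<open>k\<close> depends on the vertex \<open>x k\<close> alone. The finiteness of the
  set of orbits rests on this uniformity.\<close>

lemma surjunctive_left_tail:
  assumes surj: "surjunctive (paths E)"
  obtains c where "\<And>D x i j. \<forall>v w. E v w \<longrightarrow> w \<in> D \<longrightarrow> v \<in> D \<Longrightarrow> x \<in> paths E \<Longrightarrow> x i \<in> D \<Longrightarrow> x j \<notin> D \<Longrightarrow>
    \<exists>k. x k \<in> D \<and> x (k + (int (card V) + 1)) \<notin> D \<and> (\<forall>i\<le>k. x i = c (x k) (i - k))"
proof -
  obtain c p where "0 < p" and "\<forall>v. recurrent E v \<longrightarrow> c v \<in> paths E \<and> c v 0 = v \<and> (\<forall>i. c v (i + p) = c v i)"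
    using closed_paths_common_period by blast
  then have c: "cycle_insertion E D c p" if "\<And>v w. E v w \<Longrightarrow> w \<in> D \<Longrightarrow> v \<in> D" for D
    using that by unfold_locales blast+
  show ?thesis
  proof
    fix D x i j
    assume "\<forall>v w. E v w \<longrightarrow> w \<in> D \<longrightarrow> v \<in> D" and x: "x \<in> paths E" "x i \<in> D" "x j \<notin> D"
    then interpret cycle_insertion E D c p by (intro c) blast
    have ins: "insert_cycle ` paths E = paths E"
      using surj insert_cycle_code insert_cycle_inj unfolding surjunctive_def by blast
    obtain k where k: "mark x k" using mark_exists[OF x] ..
    have "x k \<in> D" using k by (simp add: mark_def)
    then show "\<exists>k. x k \<in> D \<and> x (k + (int (card V) + 1)) \<notin> D \<and> (\<forall>i\<le>k. x i = c (x k) (i - k))"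
      using mark_bound[OF x(1) k] forced_left_tail[OF ins x(1) k]
      unfolding bound_def by blast
  qed
qed

lemma finite_graph_converse: "finite_graph E\<inverse>\<inverse>"
proof
  have "{(v, w). E\<inverse>\<inverse> v w} = prod.swap ` {(v, w). E v w}" by force
  then show "finite {(v, w). E\<inverse>\<inverse> v w}" using finite_edges by simp
qed

text \<open>Up to translation a wandering path is a past forced by one vertex, a middle word of
  bounded length and a future forced by one vertex, so finitely many data describe it.\<close>

lemma surjunctive_finite_wandering_orbits:
  assumes surj: "surjunctive (paths E)"
  shows "finite (orbit ` wandering E)"
proof -
  interpret R: finite_graph "E\<inverse>\<inverse>" by (rule finite_graph_converse)
  have surj': "surjunctive (paths E\<inverse>\<inverse>)" using surjunctive_reflect[OF surj] by (simp add: reflect_paths)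
  obtain c where c: "\<And>D x i j. \<forall>v w. E v w \<longrightarrow> w \<in> D \<longrightarrow> v \<in> D \<Longrightarrow> x \<in> paths E \<Longrightarrow> x i \<in> D \<Longrightarrow> x j \<notin> D \<Longrightarrow>
    \<exists>k. x k \<in> D \<and> x (k + (int (card V) + 1)) \<notin> D \<and> (\<forall>i\<le>k. x i = c (x k) (i - k))"
    using surjunctive_left_tail[OF surj] by blast
  obtain c' where c': "\<And>D x i j. \<forall>v w. E\<inverse>\<inverse> v w \<longrightarrow> w \<in> D \<longrightarrow> v \<in> D \<Longrightarrow> x \<in> paths E\<inverse>\<inverse> \<Longrightarrow> x i \<in> D \<Longrightarrow> x j \<notin> D \<Longrightarrow>
    \<exists>k. x k \<in> D \<and> x (k + (int (card R.V) + 1)) \<notin> D \<and> (\<forall>i\<le>k. x i = c' (x k) (i - k))"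
    using R.surjunctive_left_tail[OF surj'] by blast
  define b where "b = card V + card R.V + 2"
  \<comment> \<open>The letters at 0 and at \<open>n\<close> determine the tails. The function
    \<open>c'\<close> describes reversed paths, hence its argument \<open>int n - i\<close>.\<close>
  define build where "build = (\<lambda>(w, n) i. if i \<le> 0 then c (w ! 0) i
    else if int n \<le> i then c' (w ! n) (int n - i) else w ! nat i)"
  have "\<exists>s\<in>lang (Suc b) \<times> {..b}. orbit x = orbit (build s)" if wand: "x \<in> wandering E" for x
  proof -
    have x: "x \<in> paths E" using wand by (simp add: wandering_def)
    obtain i j where ij: "\<not> E\<^sup>*\<^sup>* (x i) (x j)" using wand by (auto simp: wandering_def)
    \<comment> \<open>The vertices from which \<open>x j\<close> can be reached form a backward
      closed set separating \<open>x j\<close> from \<open>x i\<close>. Its complement is backward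
      closed for the reversed edges, so the same set serves for both tails.\<close>
    define D where "D = {v. E\<^sup>*\<^sup>* v (x j)}"
    have bc: "\<forall>v w. E v w \<longrightarrow> w \<in> D \<longrightarrow> v \<in> D"
      by (simp add: D_def converse_rtranclp_into_rtranclp)
    have D: "x j \<in> D" "x i \<notin> D" using ij by (auto simp: D_def)
    have back_D: "x k \<in> D" if "x l \<in> D" "k \<le> l" for k l
      using reach_in_paths[OF x] that by (auto simp: D_def)
    obtain k where k: "x k \<in> D" "x (k + (int (card V) + 1)) \<notin> D" "\<And>i. i \<le> k \<Longrightarrow> x i = c (x k) (i - k)"
      using c[OF bc x D] by blast
    have "reflect x \<in> paths E\<inverse>\<inverse>" using x reflect_paths by blast
    moreover have "\<forall>v w. E\<inverse>\<inverse> v w \<longrightarrow> w \<in> - D \<longrightarrow> v \<in> - D" using bc by auto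
    moreover have "reflect x (- i) \<in> - D" "reflect x (- j) \<notin> - D" using D by (auto simp: reflect_def)
    ultimately obtain l where l: "reflect x l \<in> - D" "reflect x (l + (int (card R.V) + 1)) \<notin> - D"
      "\<And>i. i \<le> l \<Longrightarrow> reflect x i = c' (reflect x l) (i - l)"
      using c'[of "- D" "reflect x" "- i" "- j"] by blast
    define m where "m = - l"
    have "m - (int (card R.V) + 1) = - (l + (int (card R.V) + 1))" by (simp add: m_def)
    then have m: "x m \<notin> D" "x (m - (int (card R.V) + 1)) \<in> D"
      using l(1,2) by (simp_all only: m_def reflect_def Compl_iff not_not not_False_eq_True)
    have right: "x i = c' (x m) (m - i)" if "m \<le> i" for i
      using l(3)[of "- i"] that by (simp add: m_def reflect_def minus_diff_commute)
    \<comment> \<open>The path never returns to \<open>D\<close>, so a position inside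
      \<open>D\<close> precedes every position outside. Two such comparisons give
      \<open>k < m\<close> and the bound \<open>b\<close> on \<open>m - k\<close>.\<close>
    have km: "k < m" using back_D[OF k(1), of m] m(1) by force
    have "m - (int (card R.V) + 1) < k + (int (card V) + 1)" using back_D[OF m(2)] k(2) by (metis not_less)
    then have mb: "nat (m - k) \<le> b" by (simp add: b_def)
    define w where "w = block (translate k x) (Suc b)"
    have wt: "w ! t = x (k + int t)" if "t \<le> b" for t
      using that by (simp add: w_def translate_def add.commute)
    have "build (w, nat (m - k)) i = translate k x i" for i
    proof -
      consider "i \<le> 0" | "0 < i" "i < m - k" | "m - k \<le> i" "0 < i" by linarith
      then show ?thesis
      proof cases
        case 1
        then show ?thesis using k(3)[of "i + k"] wt[of 0] by (simp add: build_def translate_def)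
      next
        case 2
        then show ?thesis using wt[of "nat i"] mb by (simp add: build_def translate_def add.commute)
      next
        case 3
        then show ?thesis using right[of "i + k"] wt[of "nat (m - k)"] mb km
          by (simp add: build_def translate_def algebra_simps)
      qed
    qed
    then have "build (w, nat (m - k)) = translate k x" ..
    then have "orbit x = orbit (build (w, nat (m - k)))" by (simp add: orbit_translate)
    moreover have "w \<in> lang (Suc b)" using translate_paths[OF x] by (auto simp: w_def lang_def)
    ultimately show ?thesis using mb by blast
  qed
  then have "orbit ` wandering E \<subseteq> (\<lambda>s. orbit (build s)) ` (lang (Suc b) \<times> {..b})" by blast
  then show ?thesis by (rule finite_subset) (simp add: finite_lang)
qed

section \<open>The Moore property from finitely many wandering orbits\<close>

lemma sliding_block_code_reach:
  assumes code: "sliding_block_code r (paths E) (paths E) \<tau>"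
    and x: "x \<in> paths E" and y: "y \<in> paths E" and reach: "E\<^sup>*\<^sup>* (x (i + r)) (y (j - r))"
  shows "E\<^sup>*\<^sup>* (\<tau> x i) (\<tau> y j)"
proof -
  have r: "0 \<le> r" by (rule sliding_block_code_nonneg[OF code])
  obtain q where "(E ^^ q) (x (i + r)) (y (j - r))" using reach by (auto simp: rtranclp_power)
  \<comment> \<open>The past of \<open>x\<close> is joined to the future of \<open>y\<close>. Around
    \<open>i\<close> the code sees only \<open>x\<close>, around the place corresponding to
    \<open>j\<close> only \<open>y\<close>, so the image of \<open>z\<close> contains the required
    walk.\<close>
  then obtain z where z: "z \<in> paths E" "\<And>l. l \<le> i + r \<Longrightarrow> z l = x l"
    "\<And>l. 0 \<le> l \<Longrightarrow> z (i + r + int q + l) = y (j - r + l)"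
    using paths_connect[OF x y] by blast
  have "\<tau> z i = \<tau> x i"
    by (rule sliding_block_code_eq[OF code z(1) x]) (simp add: z(2))
  moreover have "\<tau> z (i + r + int q + r) = \<tau> y j"
  proof (rule sliding_block_code_eq[OF code z(1) y])
    fix k :: int assume "\<bar>k\<bar> \<le> r"
    then show "z (i + r + int q + r + k) = y (j + k)" using z(3)[of "r + k"] by (simp add: algebra_simps)
  qed
  moreover have "E\<^sup>*\<^sup>* (\<tau> z i) (\<tau> z (i + r + int q + r))"
    using paths_reach[OF sliding_block_code_in[OF code z(1)]] r by simp
  ultimately show ?thesis by simp
qed

lemma translate_wandering:
  assumes "x \<in> wandering E"
  shows "translate k x \<in> wandering E"
proof -
  obtain i j where "\<not> E\<^sup>*\<^sup>* (x i) (x j)" using assms by (auto simp: wandering_def)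
  then have "\<not> E\<^sup>*\<^sup>* (translate k x (i - k)) (translate k x (j - k))" by (simp add: translate_def)
  then show ?thesis using assms translate_paths[of x E k] unfolding wandering_def by blast
qed

text \<open>A periodic path returns to each of its vertices, so all of them can reach each
  other.\<close>

lemma wandering_aperiodic:
  assumes x: "x \<in> wandering E" and eq: "translate k x = x"
  shows "k = 0"
proof (rule ccontr)
  assume "k \<noteq> 0"
  have xp: "x \<in> paths E" using x by (simp add: wandering_def)
  have per: "x (i + int (nat \<bar>k\<bar>)) = x i" for i
    using fun_cong[OF eq, of i] fun_cong[OF eq, of "i - k"] by (auto simp: translate_def abs_if)
  have "E\<^sup>*\<^sup>* (x i) (x j)" for i j
  proof -
    have "1 * \<bar>i - j\<bar> \<le> \<bar>k\<bar> * \<bar>i - j\<bar>" using \<open>k \<noteq> 0\<close> by (intro mult_right_mono) auto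
    then have "i \<le> j + int (nat \<bar>k\<bar>) * int (nat \<bar>i - j\<bar>)" by simp
    then show ?thesis using paths_reach[OF xp] periodic_multiple[of x, OF per] by metis
  qed
  then show False using x by (simp add: wandering_def)
qed


text \<open>On wandering paths \<open>\<tau>\<close> is even injective. On the others a power of
  \<open>\<tau>\<close> acts on the paths of one component, where \<open>irreducible_moore\<close>
  applies. Both cases rest on a surjection of a finite set being a permutation, once for orbits and
  once for components.\<close>

lemma moore_if_finite_wandering_orbits:
  assumes fin: "finite (orbit ` wandering E)"
    and code: "sliding_block_code r (paths E) (paths E) \<tau>" and surj: "\<tau> ` paths E = paths E"
    and x: "x \<in> paths E" and y: "y \<in> paths E" and hom: "homoclinic x y" and eq: "\<tau> x = \<tau> y"
  shows "x = y"
proof -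
  define W where "W = wandering E"
  define N where "N = paths E - W"
  have W: "z \<in> paths E" if "z \<in> W" for z using that by (simp add: W_def wandering_def)
  have N: "z \<in> N \<longleftrightarrow> z \<in> paths E \<and> (\<forall>i j. E\<^sup>*\<^sup>* (z i) (z j))" for z
    by (auto simp: N_def W_def wandering_def)
  note in_paths = sliding_block_code_in[OF code]
  have \<tau>_translate: "\<tau> (translate k z) = translate k (\<tau> z)" if "z \<in> paths E" for k z
    using sliding_block_code_translate[OF code that translate_paths[OF that]] .
  have preimage: "\<exists>z'\<in>paths E. \<tau> z' = z" if "z \<in> paths E" for z
    using that surj by (metis imageE)
  have \<tau>N: "\<tau> z \<in> N" if "z \<in> N" for z
    using that in_paths sliding_block_code_reach[OF code, of z z] by (simp add: N)
  let ?Q = "orbit ` W"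
  have finQ: "finite ?Q" using fin by (simp add: W_def)
  have \<tau>_orbit: "\<tau> ` orbit z = orbit (\<tau> z)" if "z \<in> paths E" for z
    using \<tau>_translate[OF that] by (simp add: orbit_def image_image)
  \<comment> \<open>Preimages of wandering paths are wandering because \<open>\<tau>\<close>
    preserves \<open>N\<close>. So the images of the finitely many orbits cover all of them, and by
    counting \<open>\<tau>\<close> permutes the orbits.\<close>
  have sub: "?Q \<subseteq> image \<tau> ` ?Q"
  proof
    fix q assume "q \<in> ?Q"
    then obtain z where z: "z \<in> W" "q = orbit z" by blast
    then obtain z' where z': "z' \<in> paths E" "\<tau> z' = z" using preimage W by blast
    then have "z' \<in> W" using \<tau>N z(1) by (auto simp: N_def)
    then show "q \<in> image \<tau> ` ?Q" using z z' \<tau>_orbit by (intro image_eqI[of _ _ "orbit z'"]) auto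
  qed
  have Q: "?Q = image \<tau> ` ?Q"
    by (rule card_seteq[OF finite_imageI[OF finQ] sub card_image_le[OF finQ]])
  then have injQ: "inj_on (image \<tau>) ?Q"
    using eq_card_imp_inj_on[OF finQ, of "image \<tau>"] by simp
  have \<tau>W: "\<tau> z \<in> W" if z: "z \<in> W" for z
  proof -
    have "\<tau> ` orbit z \<in> ?Q" using Q z by blast
    then obtain z' where z': "z' \<in> W" "orbit (\<tau> z) = orbit z'" using \<tau>_orbit[OF W[OF z]] by auto
    have "\<tau> z \<in> orbit (\<tau> z)" unfolding orbit_def by (metis rangeI translate_0)
    then show ?thesis using z' translate_wandering by (auto simp: orbit_def W_def)
  qed
  have injW: "z = z'" if z: "z \<in> W" and z': "z' \<in> W" and eq: "\<tau> z = \<tau> z'" for z z'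
  proof -
    have "\<tau> ` orbit z = \<tau> ` orbit z'" using \<tau>_orbit W z z' eq by simp
    \<comment> \<open>Two paths in one orbit with the same image differ by a translation fixing that
      image, which is wandering and hence aperiodic.\<close>
    then have "orbit z = orbit z'" using injQ z z' by (meson imageI inj_onD)
    moreover have "z' \<in> orbit z'" unfolding orbit_def by (metis rangeI translate_0)
    ultimately obtain k where k: "z' = translate k z" by (auto simp: orbit_def)
    then have "translate k (\<tau> z) = \<tau> z" using \<tau>_translate[OF W[OF z], of k] eq by metis
    then have "k = 0" using wandering_aperiodic[of "\<tau> z" k] \<tau>W[OF z] by (simp add: W_def)
    then show ?thesis using k by (simp add: translate_0)
  qed
  have \<tau>N_surj: "\<tau> ` N = N"
  proof
    show "N \<subseteq> \<tau> ` N"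
    proof
      fix z assume z: "z \<in> N"
      then obtain z' where z': "z' \<in> paths E" "\<tau> z' = z" using preimage by (auto simp: N_def)
      then have "z' \<in> N" using \<tau>W z by (auto simp: N_def)
      then show "z \<in> \<tau> ` N" using z' by blast
    qed
  qed (use \<tau>N in blast)
  have "x \<in> W \<longleftrightarrow> y \<in> W"
    using \<tau>W \<tau>N eq x y by (metis Diff_iff N_def)
  then consider "x \<in> W" "y \<in> W" | "x \<in> N" "y \<in> N" using x y by (auto simp: N_def)
  then show ?thesis
  proof cases
    case 1
    then show ?thesis using injW eq by blast
  next
    case 2
    \<comment> \<open>For \<open>z\<close> in \<open>N\<close> this is the strongly connected
      component containing the whole path.\<close>
    define cls where "cls z = {v. E\<^sup>*\<^sup>* (z 0) v \<and> E\<^sup>*\<^sup>* v (z 0)}" for z :: "int \<Rightarrow> 'v"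
    have cls_eq: "cls z = cls z'" if "E\<^sup>*\<^sup>* (z 0) (z' 0)" "E\<^sup>*\<^sup>* (z' 0) (z 0)" for z z'
      using that unfolding cls_def by (auto intro: rtranclp_trans)
    have cls_reach: "E\<^sup>*\<^sup>* (z i) (z' j)" if "z \<in> N" "z' \<in> N" "cls z = cls z'" for z z' i j
    proof -
      have "z 0 \<in> cls z'" using that(3) by (auto simp: cls_def)
      then have "E\<^sup>*\<^sup>* (z 0) (z' 0)" by (simp add: cls_def)
      then show ?thesis using that(1,2) N by (meson rtranclp_trans)
    qed
    let ?K = "cls ` N"
    have "cls z \<subseteq> V" if "z \<in> N" for z
      using that paths_vertex[of z 0] by (auto simp: cls_def N elim: converse_rtranclpE)
    then have finK: "finite ?K"
      by (intro finite_subset[OF _ finite_Pow_iff[THEN iffD2, OF finite_vertices]]) auto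
    have cls_\<tau>: "cls (\<tau> z) = cls (\<tau> z')" if "z \<in> N" "z' \<in> N" "cls z = cls z'" for z z'
      using that cls_reach by (intro cls_eq sliding_block_code_reach[OF code]) (auto simp: N)
    \<comment> \<open>The induced map on components; \<open>cls_\<tau>\<close> makes it independent
      of the representative. It is the identity off \<open>?K\<close>, so that it is injective on
      the whole type and \<open>funpow_inj_finite\<close> applies.\<close>
    define P where "P C = (if C \<in> ?K then cls (\<tau> (SOME z. z \<in> N \<and> cls z = C)) else C)" for C
    have P: "P (cls z) = cls (\<tau> z)" if "z \<in> N" for z
    proof -
      define z' where "z' = (SOME z'. z' \<in> N \<and> cls z' = cls z)"
      have "z' \<in> N \<and> cls z' = cls z"
        unfolding z'_def by (rule someI[of _ z]) (use that in simp)
      then have "cls (\<tau> z') = cls (\<tau> z)" using that by (intro cls_\<tau>) auto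
      then show ?thesis using that by (simp add: P_def z'_def)
    qed
    have "P ` ?K = (\<lambda>z. cls (\<tau> z)) ` N" unfolding image_image by (rule image_cong[OF refl P])
    also have "\<dots> = cls ` \<tau> ` N" by (simp add: image_image)
    also have "\<dots> = ?K" unfolding \<tau>N_surj ..
    finally have PK: "P ` ?K = ?K" .
    then have injK: "inj_on P ?K" using eq_card_imp_inj_on[OF finK, of P] by simp
    have injP: "inj P"
    proof (rule injI)
      fix C C' assume e: "P C = P C'"
      have "P C \<in> ?K \<longleftrightarrow> C \<in> ?K" for C using PK by (auto simp: P_def)
      then have "C \<in> ?K \<longleftrightarrow> C' \<in> ?K" using e by metis
      then show "C = C'" using e injK by (cases "C \<in> ?K") (auto simp: inj_on_def P_def)
    qed
    have Pn: "(P ^^ n) (cls z) = cls ((\<tau> ^^ n) z) \<and> (\<tau> ^^ n) z \<in> N" if "z \<in> N" for n z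
      using that by (induction n) (auto simp: P \<tau>N)
    have "finite {C. \<exists>n. C = (P ^^ n) (cls x)}"
      by (rule finite_subset[OF _ finK]) (use Pn[OF 2(1)] in auto)
    from funpow_inj_finite[OF injP this] obtain n where n: "0 < n" "(P ^^ n) (cls x) = cls x" .
    define T where "T = \<tau> ^^ n"
    define C where "C = cls x"
    define Z where "Z = {z \<in> N. cls z = C}"
    have "(\<tau> ^^ k) ` N = N" for k
    proof (induction k)
      case (Suc k)
      have "(\<tau> ^^ Suc k) ` N = \<tau> ` (\<tau> ^^ k) ` N" by (simp add: image_image)
      then show ?case using Suc \<tau>N_surj by simp
    qed simp
    then have TN: "T ` N = N" by (simp add: T_def)
    have TZ: "T ` Z = Z"
    proof
      show "T ` Z \<subseteq> Z" using Pn n(2) by (force simp: Z_def T_def C_def)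
      show "Z \<subseteq> T ` Z"
      proof
        fix z assume z: "z \<in> Z"
        then obtain z' where z': "z' \<in> N" "z = T z'" using TN by (auto simp: Z_def)
        then have "(P ^^ n) (cls z') = (P ^^ n) C" using Pn[OF z'(1), of n] z n(2) by (simp add: Z_def T_def C_def)
        then have "cls z' = C" using injP by (metis inj_fn injD)
        then show "z \<in> T ` Z" using z' by (auto simp: Z_def)
      qed
    qed
    have Cin: "v \<in> C \<longleftrightarrow> E\<^sup>*\<^sup>* (x 0) v \<and> E\<^sup>*\<^sup>* v (x 0)" for v by (simp add: C_def cls_def)
    \<comment> \<open>The component as a graph of its own: its paths are exactly \<open>Z\<close>,
      which \<open>T\<close> maps onto itself.\<close>
    define F where "F v w \<longleftrightarrow> E v w \<and> v \<in> C \<and> w \<in> C" for v w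
    have irrF: "F\<^sup>*\<^sup>* v w" if "v \<in> C" "w \<in> C" for v w
    proof -
      have "E\<^sup>*\<^sup>* v w" using that Cin by (meson rtranclp_trans)
      then show ?thesis using that(1)
      proof (induction rule: converse_rtranclp_induct)
        case (step v v')
        have "v' \<in> C"
          using step that(2) Cin by (meson rtranclp.rtrancl_into_rtrancl rtranclp_trans)
        then show ?case using step by (auto simp: F_def intro: converse_rtranclp_into_rtranclp)
      qed simp
    qed
    have FZ: "paths F = Z"
    proof
      show "paths F \<subseteq> Z"
      proof
        fix z assume z: "z \<in> paths F"
        then have zC: "z i \<in> C" and zE: "z \<in> paths E" for i by (auto simp: paths_def F_def)
        have "E\<^sup>*\<^sup>* (z i) (z j)" for i j using zC[of i] zC[of j] Cin by (meson rtranclp_trans)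
        moreover have "cls z = C" unfolding C_def using zC[of 0] Cin by (intro cls_eq) auto
        ultimately show "z \<in> Z" using zE by (simp add: Z_def N)
      qed
      show "Z \<subseteq> paths F"
      proof
        fix z assume z: "z \<in> Z"
        then have "z i \<in> C" for i using cls_reach[of x z 0 i] cls_reach[of z x i 0] 2(1) 
          by (simp add: Z_def C_def Cin[unfolded C_def])
        then show "z \<in> paths F" using z by (auto simp: paths_def F_def Z_def N)
      qed
    qed
    interpret F: finite_graph F
    proof
      show "finite {(v, w). F v w}" by (rule finite_subset[OF _ finite_edges]) (auto simp: F_def)
    qed
    obtain s where s: "sliding_block_code s (paths E) (paths E) T"
      using sliding_block_code_funpow[OF code] by (auto simp: T_def)
    have "sliding_block_code s (paths F) (paths F) T"
    proof (rule sliding_block_codeI)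
      show "T z \<in> paths F" if "z \<in> paths F" for z using that TZ by (auto simp: FZ)
      show "T z i = T z' j" if "z \<in> paths F" "z' \<in> paths F" "\<And>k. \<bar>k\<bar> \<le> s \<Longrightarrow> z (i + k) = z' (j + k)" for z z' i j
        by (rule sliding_block_code_eq[OF s]) (use that in \<open>auto simp: FZ Z_def N_def\<close>)
    qed (rule sliding_block_code_nonneg[OF s])
    moreover have "T ` paths F = paths F" by (simp add: FZ TZ)
    moreover have "x \<in> paths F" using 2 by (simp add: FZ Z_def C_def)
    moreover have "y \<in> paths F"
    proof -
      \<comment> \<open>Homoclinic paths agree somewhere, so their components meet and therefore
        coincide.\<close>
      have "{i. x i \<noteq> y i} \<noteq> UNIV" using hom infinite_UNIV_int by (metis homoclinic_def)
      then obtain i where i: "x i = y i" by auto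
      have "E\<^sup>*\<^sup>* (x 0) (y i)" "E\<^sup>*\<^sup>* (y i) (x 0)" using 2(1) i by (metis N)+
      then have "cls y = cls x" using 2(2) by (intro cls_eq) (meson N rtranclp_trans)+
      then show ?thesis using 2 by (simp add: FZ Z_def C_def)
    qed
    moreover have "T x = T y"
      using n(1) eq by (cases n) (simp_all add: T_def funpow_Suc_right del: funpow.simps)
    moreover have "F\<^sup>*\<^sup>* v w" if "v \<in> F.V" "w \<in> F.V" for v w using that irrF by (auto simp: F_def)
    ultimately show ?thesis using F.irreducible_moore hom by blast
  qed
qed

end

section \<open>Recoding a subshift of finite type as a graph\<close>

lemma pre_injective_iff:
  "pre_injective X \<tau> \<longleftrightarrow> (\<forall>x\<in>X. \<forall>y\<in>X. homoclinic x y \<longrightarrow> \<tau> x = \<tau> y \<longrightarrow> x = y)"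
proof
  assume pre: "pre_injective X \<tau>"
  show "\<forall>x\<in>X. \<forall>y\<in>X. homoclinic x y \<longrightarrow> \<tau> x = \<tau> y \<longrightarrow> x = y"
  proof (intro ballI impI)
    fix x y assume "x \<in> X" "y \<in> X" "homoclinic x y" "\<tau> x = \<tau> y"
    moreover have "homoclinic x x" by (simp add: homoclinic_def)
    ultimately show "x = y" using pre unfolding pre_injective_def inj_on_def by blast
  qed
next
  assume *: "\<forall>x\<in>X. \<forall>y\<in>X. homoclinic x y \<longrightarrow> \<tau> x = \<tau> y \<longrightarrow> x = y"
  have "homoclinic y z" if "homoclinic x y" "homoclinic x z" for x y z :: "int \<Rightarrow> 'a"
  proof -
    have "{i. y i \<noteq> z i} \<subseteq> {i. x i \<noteq> y i} \<union> {i. x i \<noteq> z i}" by auto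
    then show ?thesis using that unfolding homoclinic_def by (meson finite_UnI finite_subset)
  qed
  then show "pre_injective X \<tau>" using * unfolding pre_injective_def inj_on_def by blast
qed

theorem corollary1p2:
  fixes A :: "'a set" and X :: "(int \<Rightarrow> 'a) set"
  assumes "finite A"
    and "subshift_of_finite_type A X"
    and "myhill_property A X"
  shows "moore_property A X \<and> satisfies_garden_of_eden A X"
proof -
  have X: "subshift A X" using assms(2) by (simp add: subshift_of_finite_type_def)
  obtain n S where S: "X = {x \<in> topspace (full_shift A). \<forall>i. window n x i \<in> S}"
    using assms(2) by (auto simp: subshift_of_finite_type_def)
  note endo = curtis_hedlund_lyndon[OF assms(1) X]
  \<comment> \<open>A vertex has \<open>n + 1\<close> letters: its tail is the window of length
    \<open>n\<close>, and its first letter exists even for \<open>n = 0\<close>, so that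
    \<open>\<psi>\<close> inverts \<open>\<phi>\<close>.\<close>
  define \<phi> :: "(int \<Rightarrow> 'a) \<Rightarrow> int \<Rightarrow> 'a list" where "\<phi> x i = block (translate i x) (Suc n)" for x i
  define \<psi> :: "(int \<Rightarrow> 'a list) \<Rightarrow> int \<Rightarrow> 'a" where "\<psi> y i = y i ! 0" for y i
  define E where "E v w \<longleftrightarrow> (\<exists>x\<in>X. \<exists>i. v = \<phi> x i \<and> w = \<phi> x (i + 1))" for v w
  have \<phi>_nth: "\<phi> x i ! t = x (i + int t)" if "t \<le> n" for x i t
    using that by (simp add: \<phi>_def translate_def add.commute)
  have len_\<phi>: "length (\<phi> x i) = Suc n" for x i by (simp add: \<phi>_def)
  have window_\<phi>: "window n x i = tl (\<phi> x i)" for x i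
    by (rule nth_equalityI) (auto simp: window_def nth_tl len_\<phi> \<phi>_nth algebra_simps)
  have \<psi>_\<phi>: "\<psi> (\<phi> x) = x" for x by (rule ext) (simp add: \<psi>_def \<phi>_nth)
  have \<phi>_paths: "\<phi> x \<in> paths E" if "x \<in> X" for x using that by (auto simp: paths_def E_def)
  have \<psi>_paths: "\<psi> y \<in> X \<and> \<phi> (\<psi> y) = y" if y: "y \<in> paths E" for y
  proof -
    have yi: "\<exists>x\<in>X. \<exists>j. y i = \<phi> x j \<and> y (i + 1) = \<phi> x (j + 1)" for i
      using paths_step[OF y] by (simp add: E_def)
    have step: "y i ! Suc t = y (i + 1) ! t" if "t < n" for i t
      using yi[of i] that by (auto simp: \<phi>_nth algebra_simps)
    have "y i ! t = y (i + int t) ! 0" if "t \<le> n" for i t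
      using that
    proof (induction t arbitrary: i)
      case (Suc t)
      then show ?case using Suc.IH[of "i + 1"] step[of t i] by (simp add: algebra_simps)
    qed simp
    then have yt: "y i ! t = \<psi> y (i + int t)" if "t \<le> n" for i t using that unfolding \<psi>_def by blast
    have \<phi>_\<psi>: "\<phi> (\<psi> y) i = y i" for i
    proof (rule nth_equalityI)
      show "length (\<phi> (\<psi> y) i) = length (y i)" using yi[of i] len_\<phi> by metis
    qed (simp add: len_\<phi> \<phi>_nth yt)
    \<comment> \<open>Each vertex of the path occurs in a point of \<open>X\<close>, so every window
      of \<open>\<psi> y\<close> lies in \<open>S\<close>; by finite type this puts
      \<open>\<psi> y\<close> into \<open>X\<close>.\<close>
    have "window n (\<psi> y) i \<in> S \<and> \<psi> y i \<in> A" for i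
    proof -
      obtain x j where x: "x \<in> X" "y i = \<phi> x j" using yi[of i] by blast
      then have "window n (\<psi> y) i = window n x j" "\<psi> y i = x j"
        by (simp_all add: window_\<phi> \<phi>_\<psi> \<psi>_def \<phi>_nth)
      then show ?thesis using x(1) S by (simp add: topspace_full_shift)
    qed
    then show ?thesis using \<phi>_\<psi> by (auto simp: S topspace_full_shift)
  qed
  have \<phi>_code: "sliding_block_code (int n) X (paths E) \<phi>"
    by (rule sliding_block_codeI) (auto simp: \<phi>_paths intro!: nth_equalityI simp: len_\<phi> \<phi>_nth)
  have \<psi>_code: "sliding_block_code 0 (paths E) X \<psi>"
    by (rule sliding_block_codeI) (use \<psi>_paths in \<open>auto simp: \<psi>_def\<close>)
  interpret finite_graph E
  proof
    let ?L = "{v. set v \<subseteq> A \<and> length v = Suc n}"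
    have "{(v, w). E v w} \<subseteq> ?L \<times> ?L"
      using S by (auto simp: E_def \<phi>_def block_def translate_def topspace_full_shift)
    then show "finite {(v, w). E v w}"
      by (rule finite_subset) (simp add: finite_lists_length_eq[OF assms(1)])
  qed
  have "surjunctive (paths E)"
    unfolding surjunctive_def
  proof (intro allI impI)
    fix r \<tau> assume code: "sliding_block_code r (paths E) (paths E) \<tau>" and inj: "inj_on \<tau> (paths E)"
    let ?t = "\<psi> \<circ> (\<tau> \<circ> \<phi>)"
    have "endomorphism A X ?t"
      using sliding_block_code_comp[OF sliding_block_code_comp[OF \<phi>_code code] \<psi>_code] endo by blast
    moreover have "pre_injective X ?t"
      unfolding pre_injective_iff
    proof (intro ballI impI)
      fix x y assume x: "x \<in> X" and y: "y \<in> X" and "?t x = ?t y"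
      then have "\<tau> (\<phi> x) = \<tau> (\<phi> y)"
        using \<psi>_paths sliding_block_code_in[OF code] \<phi>_paths by (metis comp_apply)
      then have "\<phi> x = \<phi> y" using inj \<phi>_paths x y by (meson inj_onD)
      then show "x = y" using \<psi>_\<phi> by metis
    qed
    ultimately have t: "?t ` X = X" using assms(3) unfolding myhill_property_def by blast
    show "\<tau> ` paths E = paths E"
    proof
      show "\<tau> ` paths E \<subseteq> paths E" using sliding_block_code_in[OF code] by blast
      show "paths E \<subseteq> \<tau> ` paths E"
      proof
        fix y assume y: "y \<in> paths E"
        then have "\<psi> y \<in> ?t ` X" using \<psi>_paths t by simp
        then obtain x where x: "x \<in> X" "\<psi> y = \<psi> (\<tau> (\<phi> x))" by auto
        then have "y = \<tau> (\<phi> x)" using \<psi>_paths y sliding_block_code_in[OF code] \<phi>_paths by metis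
        then show "y \<in> \<tau> ` paths E" using \<phi>_paths x by blast
      qed
    qed
  qed
  then have fin: "finite (orbit ` wandering E)" by (rule surjunctive_finite_wandering_orbits)
  have "moore_property A X"
    unfolding moore_property_def
  proof (intro allI impI)
    fix \<tau> assume "endomorphism A X \<tau> \<and> \<tau> ` X = X"
    then obtain r where code: "sliding_block_code r X X \<tau>" and surj: "\<tau> ` X = X" using endo by blast
    let ?t = "\<phi> \<circ> (\<tau> \<circ> \<psi>)"
    have code': "sliding_block_code (0 + r + int n) (paths E) (paths E) ?t"
      by (rule sliding_block_code_comp[OF sliding_block_code_comp[OF \<psi>_code code] \<phi>_code])
    have "bij_betw \<phi> X (paths E)" "bij_betw \<psi> (paths E) X"
      using \<phi>_paths \<psi>_paths \<psi>_\<phi> by (auto intro: bij_betwI)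
    then have "\<phi> ` X = paths E" "\<psi> ` paths E = X" by (simp_all add: bij_betw_imp_surj_on)
    then have surj': "?t ` paths E = paths E" using surj by (metis image_comp)
    show "pre_injective X \<tau>"
      unfolding pre_injective_iff
    proof (intro ballI impI)
      fix x y assume xy: "x \<in> X" "y \<in> X" "homoclinic x y" "\<tau> x = \<tau> y"
      have "\<phi> x = \<phi> y"
        by (rule moore_if_finite_wandering_orbits[OF fin code' surj'])
          (use xy \<phi>_paths homoclinic_sliding_block_code[OF \<phi>_code] in \<open>auto simp: \<psi>_\<phi>\<close>)
      then show "x = y" using \<psi>_\<phi> by metis
    qed
  qed
  then show ?thesis using assms(3) by (simp add: satisfies_garden_of_eden_def)
qed

end
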